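(* Let $q>2$ be even and $1\le s\le q/5$. Then an ${\rm O}^+(8,q)$-space has a maximal orthogonal partial spread of size $n_s=q^3-sq^2+(s-1)(q+2)+\binom{s}{2}(q-2)+1$. If $q\ge16$ there is also a maximal orthogonal partial spread of size $n_4-1$. These partial spreads are also maximal symplectic partial spreads.
   Context: An ${\rm O}^+(8,q)$-space is an $8$-dimensional $\mathbb{F}_q$-space with a nondegenerate quadratic form $Q$ of plus type; for $q$ even its polar form $f(u,v)=Q(u+v)-Q(u)-Q(v)$ is a nondegenerate alternating form. An orthogonal (resp. symplectic) partial spread is a set of $4$-dimensional subspaces on which $Q$ (resp. $f$) vanishes, pairwise meeting only in $0$; maximal means not properly contained in another such. *)

theory Defs
  imports Complex_Main "HOL-Library.Cardinality"
begin

text \<open>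
  A vector space over the finite field \<open>'a\<close> is given by its scalar multiplication
  \<open>scale\<close> on an arbitrary abelian group type \<open>'v\<close>, as in the locale
  \<open>vector_space\<close> of the library.
\<close>

definition polar :: "('v::ab_group_add \<Rightarrow> 'a::field) \<Rightarrow> 'v \<Rightarrow> 'v \<Rightarrow> 'a" where
  "polar Q u v = Q (u + v) - Q u - Q v"

definition quadratic_form ::
  "('a::field \<Rightarrow> 'v::ab_group_add \<Rightarrow> 'v) \<Rightarrow> ('v \<Rightarrow> 'a) \<Rightarrow> bool" where
  "quadratic_form scale Q \<longleftrightarrow>
     (\<forall>c v. Q (scale c v) = c\<^sup>2 * Q v) \<and>
     (\<forall>u. Vector_Spaces.linear scale (*) (polar Q u)) \<and>
     (\<forall>v. Vector_Spaces.linear scale (*) (\<lambda>u. polar Q u v))"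

text \<open>
  Nondegeneracy in the sense of quadratic forms: the radical of the polar form contains
  no nonzero singular vector. Over a finite field this is equivalent, in even dimension,
  to nondegeneracy of the polar form.
\<close>

definition nondegenerate_quadratic_form :: "('v::ab_group_add \<Rightarrow> 'a::field) \<Rightarrow> bool" where
  "nondegenerate_quadratic_form Q \<longleftrightarrow>
     (\<forall>v. Q v = 0 \<and> (\<forall>u. polar Q v u = 0) \<longrightarrow> v = 0)"

definition totally_singular :: "('v::ab_group_add \<Rightarrow> 'a::field) \<Rightarrow> 'v set \<Rightarrow> bool" where
  "totally_singular Q U \<longleftrightarrow> (\<forall>u\<in>U. Q u = 0)"

definition totally_isotropic :: "('v \<Rightarrow> 'v \<Rightarrow> 'a::field) \<Rightarrow> 'v set \<Rightarrow> bool" where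
  "totally_isotropic f U \<longleftrightarrow> (\<forall>u\<in>U. \<forall>v\<in>U. f u v = 0)"

text \<open>
  In dimension \<open>8\<close>, plus type means Witt index \<open>4\<close>. Since the form is nondegenerate, totally
  singular subspaces have dimension at most \<open>4\<close>, so it suffices to ask for one of
  dimension \<open>4\<close>.
\<close>

definition O8_plus_space ::
  "('a::{field,finite} \<Rightarrow> 'v::ab_group_add \<Rightarrow> 'v) \<Rightarrow> ('v \<Rightarrow> 'a) \<Rightarrow> bool" where
  "O8_plus_space scale Q \<longleftrightarrow>
     vector_space scale \<and>
     vector_space.dim scale UNIV = 8 \<and>
     quadratic_form scale Q \<and>
     nondegenerate_quadratic_form Q \<and>
     (\<exists>U. module.subspace scale U \<and> vector_space.dim scale U = 4 \<and> totally_singular Q U)"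

definition orthogonal_partial_spread ::
  "('a::field \<Rightarrow> 'v::ab_group_add \<Rightarrow> 'v) \<Rightarrow> ('v \<Rightarrow> 'a) \<Rightarrow> 'v set set \<Rightarrow> bool" where
  "orthogonal_partial_spread scale Q S \<longleftrightarrow>
     (\<forall>U\<in>S. module.subspace scale U \<and> vector_space.dim scale U = 4 \<and> totally_singular Q U) \<and>
     (\<forall>U\<in>S. \<forall>W\<in>S. U \<noteq> W \<longrightarrow> U \<inter> W = {0})"

definition symplectic_partial_spread ::
  "('a::field \<Rightarrow> 'v::ab_group_add \<Rightarrow> 'v) \<Rightarrow> ('v \<Rightarrow> 'v \<Rightarrow> 'a) \<Rightarrow> 'v set set \<Rightarrow> bool" where
  "symplectic_partial_spread scale f S \<longleftrightarrow>
     (\<forall>U\<in>S. module.subspace scale U \<and> vector_space.dim scale U = 4 \<and> totally_isotropic f U) \<and>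
     (\<forall>U\<in>S. \<forall>W\<in>S. U \<noteq> W \<longrightarrow> U \<inter> W = {0})"

definition maximal_orthogonal_partial_spread ::
  "('a::field \<Rightarrow> 'v::ab_group_add \<Rightarrow> 'v) \<Rightarrow> ('v \<Rightarrow> 'a) \<Rightarrow> 'v set set \<Rightarrow> bool" where
  "maximal_orthogonal_partial_spread scale Q S \<longleftrightarrow>
     orthogonal_partial_spread scale Q S \<and>
     \<not> (\<exists>T. orthogonal_partial_spread scale Q T \<and> S \<subset> T)"

definition maximal_symplectic_partial_spread ::
  "('a::field \<Rightarrow> 'v::ab_group_add \<Rightarrow> 'v) \<Rightarrow> ('v \<Rightarrow> 'v \<Rightarrow> 'a) \<Rightarrow> 'v set set \<Rightarrow> bool" where
  "maximal_symplectic_partial_spread scale f S \<longleftrightarrow>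
     symplectic_partial_spread scale f S \<and>
     \<not> (\<exists>T. symplectic_partial_spread scale f T \<and> S \<subset> T)"

definition spread_size :: "nat \<Rightarrow> nat \<Rightarrow> int" where
  "spread_size q s =
     int q ^ 3 - int s * int q ^ 2 + (int s - 1) * (int q + 2)
       + int (s choose 2) * (int q - 2) + 1"

end

theory Submission
  imports Defs "HOL-Computational_Algebra.Polynomial" "HOL-Library.Product_Plus"
begin

text \<open>
  By triality, totally singular \<open>4\<close>-spaces of one family meet only in \<open>0\<close> iff the corresponding
  singular points are not orthogonal, so it suffices to find maximal partial ovoids. On
  \<open>M\<^sub>2(F) \<oplus> M\<^sub>2(F)\<close>, with the form \<open>det A + \<beta> det B\<close>, the group \<open>SL\<^sub>2(q)\<close> stabilizes a Desarguesian
  ovoid: it has \<open>q + 1\<close> points in the first summand, and is regular on the remaining ones, which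
  project to the second summand as the elements \<open>g\<close> of \<open>SL\<^sub>2(q)\<close>. Given pairwise nonorthogonal singular
  points \<open>x\<close> of the second summand, remove from the ovoid all points orthogonal to one of them and
  adjoin the points \<open>x\<close>. One, two or three of the linear conditions \<open>g \<bottom> x\<close> have \<open>q\<^sup>2 - q\<close>, \<open>q - 1\<close> or
  \<open>1\<close> solutions in \<open>SL\<^sub>2(q)\<close>. For points \<open>x\<close> of a conic the last solution is always the same one, which
  gives the size \<open>n\<^sub>s\<close>; a fourth point outside of the conic gives \<open>n\<^sub>4 - 1\<close>.

  Suppose that a singular point \<open>p\<close> could be adjoined. It is orthogonal to at least \<open>q\<^sup>2 + 1\<close> points of
  the ovoid, all of which have been removed. But for each \<open>x\<close> the \<open>g \<bottom> x\<close> orthogonal to \<open>p\<close> satisfy a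
  cubic equation with at most \<open>3q\<close> solutions, so that \<open>q\<^sup>2 + 1 \<le> q + 1 + 3qs\<close>, a contradiction.

  Triality is replaced by coordinates in which one member of the partial spread is \<open>{0} \<times> F\<^sup>4\<close>.
  Totally singular complements of it are graphs of alternating matrices, totally isotropic ones
  are graphs of symmetric matrices \<open>N + d d\<^sup>T\<close> with \<open>N\<close> alternating, and two graphs of alternating
  matrices meet nontrivially iff the Pfaffian of the sum vanishes. In this case the kernel has
  dimension at least \<open>2\<close>, hence contains a nonzero vector orthogonal to \<open>d\<close>; therefore passing from \<open>N\<close> to
  \<open>N + d d\<^sup>T\<close> does not help to avoid the members of the partial spread.
\<close>

section \<open>The ovoid\<close>

type_synonym 'a mat2 = "'a \<times> 'a \<times> 'a \<times> 'a"

text \<open>Signs are dropped, as these notions serve in characteristic 2 only: \<open>pol2\<close>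
  is the polar form of this determinant and \<open>adj2\<close> the adjugate.\<close>

fun det2 :: "'a::field mat2 \<Rightarrow> 'a" where
  "det2 (a, b, c, d) = a * d + b * c"

fun pol2 :: "'a::field mat2 \<Rightarrow> 'a mat2 \<Rightarrow> 'a" where
  "pol2 (a, b, c, d) (a', b', c', d') = a * d' + d * a' + b * c' + c * b'"

fun mul2 :: "'a::field mat2 \<Rightarrow> 'a mat2 \<Rightarrow> 'a mat2" where
  "mul2 (a, b, c, d) (a', b', c', d') = (a * a' + b * c', a * b' + b * d', c * a' + d * c', c * b' + d * d')"

fun adj2 :: "'a::field mat2 \<Rightarrow> 'a mat2" where
  "adj2 (a, b, c, d) = (d, b, c, a)"

text \<open>Transposed entrywise square. It reverses products, so sending \<open>A\<close> to
  \<open>k A (frobT k)\<close> is a left action.\<close>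

fun frobT :: "'a::field mat2 \<Rightarrow> 'a mat2" where
  "frobT (a, b, c, d) = (a * a, c * c, b * b, d * d)"

fun smul4 :: "'a::field \<Rightarrow> 'a mat2 \<Rightarrow> 'a mat2" where
  "smul4 k (a, b, c, d) = (k * a, k * b, k * c, k * d)"

locale cubic =
  fixes \<beta> :: "'a::{field,finite}"
  assumes char2: "(1::'a) + 1 = 0"
    and no_root: "y * y * y + y + \<beta> \<noteq> 0"
begin

section \<open>Characteristic 2 arithmetic and anisotropic cubic forms\<close>

lemma add_self [simp]: "x + x = (0::'a)"
proof -
  have "x + x = x * (1 + 1)" by (simp only: distrib_left mult_1_right)
  then show ?thesis by (simp only: char2 mult_zero_right)
qed

lemma add_self_left [simp]: "x + (x + y) = (y::'a)"
  by (simp add: add.assoc [symmetric])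

lemma minus_char2: "- x = (x::'a)" "x - y = (x + y::'a)"
proof -
  show *: "- x = x" for x :: 'a by (metis add_self minus_unique)
  show "x - y = x + y" by (metis * diff_conv_add_uminus)
qed

lemma add_eq_0_char2: "x + y = 0 \<longleftrightarrow> x = (y::'a)"
  by (metis add_self minus_unique minus_char2(1))

lemmas poly2 = distrib_left distrib_right mult.assoc mult.commute mult.left_commute
  add.assoc add.commute add.left_commute

text \<open>With \<open>t\<^sup>3 = t + \<beta>\<close>, these are the norms of \<open>x + y t\<close> and of \<open>x + y t + z t\<^sup>2\<close> over the ground field.
  The identity below is the norm of \<open>(x + y t + z t\<^sup>2) (y + z t)\<close>, which is linear in \<open>t\<close>.\<close>

definition cub :: "'a \<Rightarrow> 'a \<Rightarrow> 'a" where
  "cub x y = x * x * x + x * y * y + \<beta> * y * y * y"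

definition nrm :: "'a \<Rightarrow> 'a \<Rightarrow> 'a \<Rightarrow> 'a" where
  "nrm x y z = x * x * x + \<beta> * y * y * y + \<beta> * \<beta> * z * z * z + \<beta> * y * z * z + x * y * y + x * z * z
     + \<beta> * x * y * z"

lemma nrm_mult_cub: "nrm x y z * cub y z = cub (\<beta> * z * z + x * y) (z * z + y * y + x * z)"
  unfolding nrm_def cub_def by (simp add: poly2)

lemma beta_neq_0 [simp]: "\<beta> \<noteq> 0"
  using no_root [of 0] by simp

lemma cub_eq_0_iff: "cub x y = 0 \<longleftrightarrow> x = 0 \<and> y = 0"
proof
  assume *: "cub x y = 0"
  show "x = 0 \<and> y = 0"
  proof (cases "y = 0")
    case False
    have "(x / y) * (x / y) * (x / y) + x / y + \<beta> = cub x y / (y * y * y)"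
      using False by (simp add: cub_def field_simps)
    then show ?thesis using * no_root by (metis div_0)
  qed (use * in \<open>simp add: cub_def\<close>)
qed (simp add: cub_def)

text \<open>A zero of the norm makes both arguments of \<open>cub\<close> in
  \<open>nrm_mult_cub\<close> vanish, since \<open>cub\<close> is anisotropic by
  \<open>no_root\<close>. Eliminating \<open>x\<close> from these two equations gives
  \<open>cub y z = 0\<close>.\<close>

lemma nrm_eq_0_iff: "nrm x y z = 0 \<longleftrightarrow> x = 0 \<and> y = 0 \<and> z = 0"
proof
  assume *: "nrm x y z = 0"
  then have "cub (\<beta> * z * z + x * y) (z * z + y * y + x * z) = 0"
    by (metis nrm_mult_cub mult_zero_left)
  then have 1: "\<beta> * z * z + x * y = 0" and 2: "z * z + y * y + x * z = 0"
    by (simp_all add: cub_eq_0_iff)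
  have "cub y z = y * (z * z + y * y + x * z) + z * (\<beta> * z * z + x * y)"
    unfolding cub_def by (simp add: poly2)
  then have "y = 0 \<and> z = 0" using 1 2 by (simp add: cub_eq_0_iff)
  then show "x = 0 \<and> y = 0 \<and> z = 0" using * by (simp add: nrm_def)
qed (simp add: nrm_def)

section \<open>The action of \<open>SL(2,q)\<close> and nonorthogonality of the points of the
  ovoid\<close>

lemma pol2_mul2_left: "pol2 (mul2 k A) (mul2 k B) = det2 k * pol2 A (B :: 'a mat2)"
  by (cases k; cases A; cases B) (simp add: poly2)

lemma pol2_mul2_right: "pol2 (mul2 A k) (mul2 B k) = det2 k * pol2 A (B :: 'a mat2)"
  by (cases k; cases A; cases B) (simp add: poly2)

lemma det2_mul2: "det2 (mul2 A B) = det2 A * det2 (B :: 'a mat2)"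
  by (cases A; cases B) (simp add: poly2)

lemma mul2_assoc: "mul2 (mul2 A B) C = mul2 A (mul2 B (C :: 'a mat2))"
  by (cases A; cases B; cases C) (simp add: poly2)

lemma frobT_mul2: "frobT (mul2 A B) = mul2 (frobT B) (frobT (A :: 'a mat2))"
  by (cases A; cases B) (simp add: poly2)

lemma det2_frobT: "det2 (frobT A) = det2 A * det2 (A :: 'a mat2)"
  by (cases A) (simp add: poly2)

text \<open>The points of the ovoid \<open>omega\<close> correspond to \<open>PG(1, q\<^sup>3)\<close>: \<open>sig\<close> gives those of the subline
  \<open>PG(1, q)\<close>, and \<open>psi g\<close> is the image under \<open>g\<close> of the point \<open>t\<close> with \<open>t\<^sup>3 = t + \<beta>\<close>, whose first component
  is \<open>M0\<close>. Here \<open>g\<close> acts by \<open>A \<mapsto> g A (g\<^sup>(\<^sup>2\<^sup>))\<^sup>T\<close> on the first component, where \<open>(2)\<close> denotes the squaring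
  automorphism, and by left multiplication on the second one.\<close>

definition M0 :: "'a mat2" where "M0 = (1, 1, 0, \<beta>)"

definition sl2 :: "'a mat2 set" where "sl2 = {g. det2 g = 1}"

abbreviation one2 :: "'a mat2" where "one2 \<equiv> (1, 0, 0, 1)"

lemma mul2_adj2:
  assumes "det2 (h :: 'a mat2) = 1"
  shows "mul2 (adj2 h) h = one2" "mul2 h (adj2 h) = one2" "det2 (adj2 h) = 1"
  using assms by (cases h, simp add: poly2)+

lemma mul2_one2: "mul2 one2 A = (A :: 'a mat2)" "mul2 A one2 = A"
  by (cases A, simp)+

fun quad8 :: "'a mat2 \<times> 'a mat2 \<Rightarrow> 'a" where
  "quad8 (A, B) = det2 A + \<beta> * det2 B"

fun pol8 :: "'a mat2 \<times> 'a mat2 \<Rightarrow> 'a mat2 \<times> 'a mat2 \<Rightarrow> 'a" where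
  "pol8 (A, B) (A', B') = pol2 A A' + \<beta> * pol2 B B'"

definition curve :: "'a mat2 \<Rightarrow> 'a mat2" where
  "curve g = mul2 (mul2 g M0) (frobT g)"

definition psi :: "'a mat2 \<Rightarrow> 'a mat2 \<times> 'a mat2" where
  "psi g = (curve g, g)"

text \<open>The rank one matrix \<open>u (u^2)^T\<close> with the entrywise square, which transforms
  under the action in the same way as \<open>curve\<close>.\<close>

fun veronese :: "'a \<times> 'a \<Rightarrow> 'a mat2" where
  "veronese (x, y) = (x * x * x, x * y * y, y * x * x, y * y * y)"

definition sig :: "'a \<times> 'a \<Rightarrow> 'a mat2 \<times> 'a mat2" where
  "sig u = (veronese u, (0, 0, 0, 0))"

lemma pol8_commute: "pol8 p p' = pol8 p' p"
  by (cases p rule: quad8.cases; cases p' rule: quad8.cases) (auto simp: poly2 split: prod.splits)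

lemma pol8_self: "pol8 p p = 0"
  by (cases p rule: quad8.cases) (auto simp: poly2 split: prod.splits)

lemma curve_mul2: "curve (mul2 k g) = mul2 (mul2 k (curve g)) (frobT k)"
  by (simp add: curve_def frobT_mul2 mul2_assoc)

lemma pol8_psi_mul2:
  assumes "det2 k = 1"
  shows "pol8 (psi (mul2 k g)) (psi (mul2 k h)) = pol8 (psi g) (psi h)"
  using assms by (simp add: psi_def curve_mul2 pol2_mul2_left pol2_mul2_right det2_frobT)

lemma pol8_psi_one2:
  assumes "det2 (a, b, c, d) = 1"
  shows "pol8 (psi (a, b, c, d)) (psi one2) = nrm c (a + d) b"
proof -
  have "pol8 (psi (a, b, c, d)) (psi one2) = pol2 (curve (a, b, c, d)) M0 + \<beta> * (a + d)"
    by (simp add: psi_def curve_def M0_def poly2)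
  \<comment> \<open>The factor \<open>det2 = 1\<close> turns the linear term into a cubic one, so
    that the comparison with \<open>nrm\<close> is an identity in all four entries.\<close>
  also have "\<dots> = pol2 (curve (a, b, c, d)) M0 + \<beta> * (a + d) * det2 (a, b, c, d)"
    using assms by simp
  also have "\<dots> = nrm c (a + d) b"
    by (simp add: curve_def M0_def nrm_def poly2)
  finally show ?thesis .
qed

lemma sq_eq_1_iff: "x * x = 1 \<longleftrightarrow> x = (1::'a)"
proof -
  have "(x + 1) * (x + 1) = x * x + 1" by (simp add: poly2)
  then show ?thesis by (metis add_eq_0_char2 mult_eq_0_iff)
qed

text \<open>Invariance moves \<open>h\<close> to \<open>one2\<close>. The value is then a norm, and
  its vanishing leaves a scalar matrix of determinant 1, which is \<open>one2\<close> because
  squaring is injective.\<close>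

lemma pol8_psi_eq_0:
  assumes "g \<in> sl2" "h \<in> sl2" "pol8 (psi g) (psi h) = 0"
  shows "g = h"
proof -
  define m where "m = mul2 (adj2 h) g"
  obtain a b c d where m: "m = (a, b, c, d)" by (cases m)
  have h: "det2 h = 1" and g: "det2 g = 1" using assms by (auto simp: sl2_def)
  have dm: "det2 m = 1" using g h by (simp add: m_def det2_mul2 mul2_adj2)
  have "pol8 (psi m) (psi one2) = pol8 (psi g) (psi h)"
    using pol8_psi_mul2 [of "adj2 h" g h] h by (simp add: m_def mul2_adj2)
  then have "nrm c (a + d) b = 0"
    using assms pol8_psi_one2 dm m by metis
  then have "c = 0" "a = d" "b = 0" by (auto simp: nrm_eq_0_iff add_eq_0_char2)
  then have "m = one2" using dm m by (auto simp: sq_eq_1_iff)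
  then have "mul2 h m = h" by (simp add: mul2_one2)
  then show "g = h" by (simp add: m_def mul2_assoc [symmetric] mul2_adj2 h mul2_one2)
qed

lemma pol8_sig: "pol8 (sig (x, y)) (sig (x', y')) = (x * y' + y * x') * (x * y' + y * x') * (x * y' + y * x')"
  by (simp add: sig_def poly2)

definition act2 :: "'a mat2 \<Rightarrow> 'a \<times> 'a \<Rightarrow> 'a \<times> 'a" where
  "act2 g u = (case (g, u) of ((a, b, c, d), (x, y)) \<Rightarrow> (a * x + b * y, c * x + d * y))"

lemma act2_mul2: "act2 (mul2 h k) u = act2 h (act2 k u)"
  by (cases h; cases k; cases u) (simp add: act2_def poly2)

lemma act2_one2: "act2 one2 u = u"
  by (cases u) (simp add: act2_def)

lemma veronese_act2: "veronese (act2 k u) = mul2 (mul2 k (veronese u)) (frobT k)"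
  by (cases k; cases u) (simp add: act2_def poly2)

text \<open>Invariance moves \<open>h\<close> to \<open>one2\<close> and \<open>u\<close> to another
  nonzero vector, where the value is the anisotropic \<open>cub\<close>.\<close>

lemma pol8_sig_psi:
  assumes "h \<in> sl2" "u \<noteq> (0, 0)"
  shows "pol8 (sig u) (psi h) \<noteq> 0"
proof -
  have h: "det2 h = 1" using assms by (auto simp: sl2_def)
  obtain x y where v: "act2 (adj2 h) u = (x, y)" by (cases "act2 (adj2 h) u")
  have "act2 h (x, y) = u"
    using h act2_mul2 [of h "adj2 h" u] by (simp add: v mul2_adj2 act2_one2)
  then have "(x, y) \<noteq> (0, 0)" using assms by (cases h) (auto simp: act2_def)
  have "pol8 (sig u) (psi h) = pol2 (veronese u) (curve h)"
    by (cases h) (simp add: sig_def psi_def)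
  also have "\<dots> = pol2 (veronese (act2 (adj2 h) u)) (curve (mul2 (adj2 h) h))"
    by (simp only: veronese_act2 curve_mul2 pol2_mul2_left pol2_mul2_right det2_frobT mul2_adj2(3) [OF h] mult_1)
  also have "\<dots> = cub y x"
    unfolding v using h by (simp add: mul2_adj2 curve_def M0_def cub_def poly2)
  finally show ?thesis using \<open>(x, y) \<noteq> (0, 0)\<close> by (auto simp: cub_eq_0_iff)
qed

definition subline :: "('a \<times> 'a) set" where
  "subline = insert (0, 1) (range (Pair 1))"

definition omega :: "('a mat2 \<times> 'a mat2) set" where
  "omega = psi ` sl2 \<union> sig ` subline"

lemma pol8_subline:
  assumes "u \<in> subline" "v \<in> subline" "pol8 (sig u) (sig v) = 0"
  shows "u = v"
  using assms by (auto simp: subline_def pol8_sig add_eq_0_char2)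

lemma pol8_omega:
  assumes "z \<in> omega" "z' \<in> omega" "pol8 z z' = 0"
  shows "z = z'"
proof -
  have "u \<noteq> (0, 0)" if "u \<in> subline" for u using that by (auto simp: subline_def)
  then have *: "pol8 (sig u) (psi h) \<noteq> 0" "pol8 (psi h) (sig u) \<noteq> 0" if "u \<in> subline" "h \<in> sl2" for u h
    using that pol8_sig_psi pol8_commute by metis+
  have "pol8 (psi g) (psi h) \<noteq> 0 \<or> g = h" if "g \<in> sl2" "h \<in> sl2" for g h
    using that pol8_psi_eq_0 by blast
  then show ?thesis
    using assms * pol8_subline unfolding omega_def by blast
qed

lemma quad8_omega:
  assumes "z \<in> omega" shows "quad8 z = 0"
proof -
  have "det2 (curve g) = \<beta>" if "det2 g = 1" for g
    using that by (simp only: curve_def det2_mul2 det2_frobT) (simp add: M0_def)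
  then have "quad8 (psi g) = 0" if "g \<in> sl2" for g
    using that by (simp add: psi_def sl2_def)
  moreover have "quad8 (sig u) = 0" for u
    by (cases u) (simp add: sig_def poly2)
  ultimately show ?thesis using assms by (auto simp: omega_def)
qed

section \<open>The number of points of the ovoid\<close>

lemma card_sl2: "card sl2 + CARD('a) = CARD('a) ^ 3"
proof -
  let ?q = "CARD('a)" and ?F = "UNIV - {0::'a}"
  have "sl2 = (\<lambda>(a, b, c). (a, b, c, (1 + b * c) / a)) ` (?F \<times> UNIV \<times> UNIV)
     \<union> (\<lambda>(b, d). (0, b, 1 / b, d)) ` (?F \<times> UNIV)" (is "_ = ?A \<union> ?B")
  proof (intro equalityI subsetI)
    fix g assume g: "g \<in> sl2"
    obtain a b c d where e: "g = (a, b, c, d)" by (cases g)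
    have e1: "a * d + b * c = 1" using g by (simp add: e sl2_def)
    show "g \<in> ?A \<union> ?B"
    proof (cases "a = 0")
      case True
      then have "b \<noteq> 0" "c = 1 / b" using e1 by (auto simp: eq_divide_eq mult.commute)
      then show ?thesis using True e by auto
    next
      case False
      have "a * d = 1 + b * c" using e1 by (metis add_self_left add.commute)
      then have "d = (1 + b * c) / a" using False by (metis nonzero_mult_div_cancel_left)
      then have "g = (\<lambda>(a, b, c). (a, b, c, (1 + b * c) / a)) (a, b, c)" by (simp add: e)
      then show ?thesis using False by (intro UnI1 image_eqI [of _ _ "(a, b, c)"]) auto
    qed
  qed (auto simp: sl2_def add.assoc split: if_splits)
  moreover have "inj_on (\<lambda>(a, b, c). (a, b, c, (1 + b * c) / a)) (?F \<times> UNIV \<times> UNIV)"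
    "inj_on (\<lambda>(b, d). (0::'a, b, 1 / b, d)) (?F \<times> (UNIV :: 'a set))"
    by (auto simp: inj_on_def)
  then have "card ?A = (?q - 1) * (?q * ?q)" "card ?B = (?q - 1) * ?q"
    by (simp_all add: card_image card_cartesian_product)
  moreover have "card (?A \<union> ?B) = card ?A + card ?B"
    by (rule card_Un_disjoint) auto
  ultimately have "card sl2 = (?q - 1) * (?q * ?q) + (?q - 1) * ?q" by simp
  moreover obtain n where "?q = Suc n" using not0_implies_Suc by force
  ultimately show ?thesis by (simp add: algebra_simps power3_eq_cube)
qed

lemma card_subline: "card subline = CARD('a) + 1"
proof -
  have "card (range (Pair (1::'a)) :: ('a \<times> 'a) set) = CARD('a)" by (intro card_image) (auto simp: inj_on_def)
  then show ?thesis unfolding subline_def by (subst card_insert_disjoint) auto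
qed

lemma card_omega: "card omega = CARD('a) ^ 3 + 1"
proof -
  have 1: "inj_on psi sl2" by (auto simp: inj_on_def psi_def)
  have 2: "inj_on sig subline" using pol8_subline pol8_self by (metis inj_onI)
  have "psi ` sl2 \<inter> sig ` subline = {}"
    by (auto simp: psi_def sig_def sl2_def)
  then have "card omega = card sl2 + card subline"
    unfolding omega_def by (simp add: card_Un_disjoint card_image 1 2)
  then show ?thesis using card_sl2 card_subline by simp
qed
end

section \<open>Hyperplane sections of the ovoid\<close>

text \<open>The rank one matrix \<open>(1,t)^T (1,r)\<close>. On the hyperbolic quadric
  \<open>det2 = 0\<close>, \<open>t\<close> and \<open>r\<close> label the lines of the two rulings
  through this point; \<open>opposite\<close> points lie on no common line.\<close>

fun xpt :: "'a::field \<times> 'a \<Rightarrow> 'a mat2" where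
  "xpt (t, r) = (1, r, t, t * r)"

definition opposite :: "'a \<times> 'b \<Rightarrow> 'a \<times> 'b \<Rightarrow> bool" where
  "opposite x y \<longleftrightarrow> fst x \<noteq> fst y \<and> snd x \<noteq> snd y"

context cubic
begin

definition hyp :: "'a \<times> 'a \<Rightarrow> 'a mat2 set" where
  "hyp x = {g \<in> sl2. pol2 g (xpt x) = 0}"

lemma pol2_xpt_eq_0_iff: "pol2 (xpt x) (xpt (y :: 'a \<times> 'a)) = 0 \<longleftrightarrow> \<not> opposite x y"
proof -
  obtain t r t' r' where e: "x = (t, r)" "y = (t', r')" by fastforce
  have "pol2 (xpt x) (xpt y) = (t + t') * (r + r')"
    by (simp add: e poly2)
  then show ?thesis by (simp only: e opposite_def mult_eq_0_iff add_eq_0_char2 fst_conv snd_conv de_Morgan_conj not_not)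
qed

lemma card_zero_diag:
  assumes "D \<noteq> (0::'a)"
  shows "card {g. det2 g = D \<and> fst g = 0} = CARD('a) * (CARD('a) - 1)"
    and "card {g. det2 g = D \<and> fst g = 0 \<and> snd (snd (snd g)) = 0} = CARD('a) - 1"
proof -
  let ?F = "UNIV - {0::'a}"
  have "{g. det2 g = D \<and> fst g = 0} = (\<lambda>(b, d). (0, b, D / b, d)) ` (?F \<times> UNIV)"
    using assms by (auto simp: image_iff eq_divide_eq mult.commute)
  moreover have "inj_on (\<lambda>(b, d). (0::'a, b, D / b, d)) (?F \<times> (UNIV :: 'a set))"
    by (auto simp: inj_on_def)
  ultimately show "card {g. det2 g = D \<and> fst g = 0} = CARD('a) * (CARD('a) - 1)"
    by (simp add: card_image card_cartesian_product mult.commute)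
  have "{g. det2 g = D \<and> fst g = 0 \<and> snd (snd (snd g)) = 0} = (\<lambda>b. (0, b, D / b, 0)) ` ?F"
    using assms by (auto simp: image_iff eq_divide_eq mult.commute)
  moreover have "inj_on (\<lambda>b. (0::'a, b, D / b, 0::'a)) ?F" by (auto simp: inj_on_def)
  ultimately show "card {g. det2 g = D \<and> fst g = 0 \<and> snd (snd (snd g)) = 0} = CARD('a) - 1"
    by (simp add: card_image)
qed

text \<open>For opposite \<open>x\<close>, \<open>y\<close> this change of coordinates takes \<open>pol2 g (xpt x)\<close> and \<open>pol2 g (xpt y)\<close>
  to the diagonal entries of the matrix.\<close>

definition trans :: "'a \<times> 'a \<Rightarrow> 'a \<times> 'a \<Rightarrow> 'a mat2 \<Rightarrow> 'a mat2" where
  "trans x y g = mul2 (mul2 (fst x, 1, fst y, 1) g) (snd x, snd y, 1, 1)"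

lemma inj_trans:
  assumes "opposite x y" shows "inj (trans x y)"
proof -
  have *: "mul2 (smul4 (1 / det2 k) (adj2 k)) k = one2" "mul2 k (smul4 (1 / det2 k) (adj2 k)) = one2"
    if "det2 k \<noteq> 0" for k :: "'a mat2"
    using that by (cases k, simp add: mult.commute add.commute flip: add_divide_distrib)+
  let ?P = "(fst x, 1, fst y, 1)" and ?R = "(snd x, snd y, 1, 1)"
  have "det2 ?P \<noteq> 0" "det2 ?R \<noteq> 0"
    using assms by (auto simp: opposite_def add_eq_0_char2)
  then have "mul2 (mul2 (smul4 (1 / det2 ?P) (adj2 ?P)) (trans x y g)) (smul4 (1 / det2 ?R) (adj2 ?R)) = g" for g
    unfolding trans_def by (metis * mul2_assoc mul2_one2)
  then show ?thesis by (metis injI)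
qed

lemma surj_trans:
  assumes "opposite x y" shows "surj (trans x y)"
  using inj_trans [OF assms] by (simp add: finite_UNIV_inj_surj)

lemma det2_trans: "det2 (trans x y g) = (fst x + fst y) * (snd x + snd y) * det2 g"
  by (simp add: trans_def det2_mul2 poly2)

lemma diag_trans:
  "fst (trans x y g) = pol2 g (xpt x)" "snd (snd (snd (trans x y g))) = pol2 g (xpt y)"
  by (cases g; cases x; cases y; simp add: trans_def poly2)+

lemma opposite_neq_0: "opposite x y \<Longrightarrow> (fst x + fst y) * (snd x + snd y) \<noteq> (0::'a)"
  by (auto simp: opposite_def add_eq_0_char2)

text \<open>As \<open>trans x y\<close> is a bijection that multiplies \<open>det2\<close> by a
  nonzero constant, subsets of \<open>sl2\<close> can be counted in the new coordinates with another
  determinant.\<close>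

lemma trans_image:
  assumes "opposite x y" and P: "\<And>g. g \<in> S \<longleftrightarrow> det2 g = 1 \<and> P (trans x y g)"
  shows "trans x y ` S = {g. det2 g = (fst x + fst y) * (snd x + snd y) \<and> P g}"
proof -
  have "det2 g = 1 \<longleftrightarrow> det2 (trans x y g) = (fst x + fst y) * (snd x + snd y)" for g
    using opposite_neq_0 [OF assms(1)] by (simp add: det2_trans)
  then have "g \<in> S \<longleftrightarrow> trans x y g \<in> {g. det2 g = (fst x + fst y) * (snd x + snd y) \<and> P g}" for g
    using P by simp
  then have "S = trans x y -` {g. det2 g = (fst x + fst y) * (snd x + snd y) \<and> P g}" by blast
  then show ?thesis using surj_trans [OF assms(1)] by (simp only: surj_image_vimage_eq)
qed

lemma card_hyp: "card (hyp x) = CARD('a) * (CARD('a) - 1)"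
proof -
  \<comment> \<open>Any opposite point can serve to define the coordinates.\<close>
  define y where "y = (fst x + 1, snd x + 1)"
  have xy: "opposite x y" by (simp add: opposite_def y_def)
  have "trans x y ` hyp x = {g. det2 g = (fst x + fst y) * (snd x + snd y) \<and> fst g = 0}"
    using xy by (rule trans_image) (simp add: hyp_def sl2_def diag_trans)
  also have "card \<dots> = CARD('a) * (CARD('a) - 1)"
    using card_zero_diag(1) [OF opposite_neq_0 [OF xy]] .
  finally show ?thesis using inj_trans [OF xy] by (metis card_image inj_on_subset subset_UNIV)
qed

lemma card_hyp_Int:
  assumes xy: "opposite x y" shows "card (hyp x \<inter> hyp y) = CARD('a) - 1"
proof -
  have "trans x y ` (hyp x \<inter> hyp y) =
      {g. det2 g = (fst x + fst y) * (snd x + snd y) \<and> fst g = 0 \<and> snd (snd (snd g)) = 0}"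
    using xy by (rule trans_image) (auto simp: hyp_def sl2_def diag_trans)
  also have "card \<dots> = CARD('a) - 1"
    using card_zero_diag(2) [OF opposite_neq_0 [OF xy]] .
  finally show ?thesis using inj_trans [OF xy] by (metis card_image inj_on_subset subset_UNIV)
qed

lemma sq_inj: "x * x = y * y \<Longrightarrow> x = (y::'a)"
proof -
  have "(x + y) * (x + y) = x * x + y * y" by (simp add: poly2)
  then show "x * x = y * y \<Longrightarrow> x = y" by (metis add_self add_eq_0_char2 mult_eq_0_iff)
qed

lemma sq_surj: "\<exists>s. s * s = (x::'a)"
proof -
  have "inj (\<lambda>x::'a. x * x)" using sq_inj by (auto intro: injI)
  then have "surj (\<lambda>x::'a. x * x)" by (simp add: finite_UNIV_inj_surj)
  then obtain s where "x = s * s" by (rule surjE)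
  then show ?thesis by metis
qed

text \<open>In the coordinates \<open>trans x y\<close> the diagonal vanishes and the third
  condition fixes the ratio of the other two entries. Their product is fixed as well, so one entry
  is a square root, which exists and is unique in characteristic 2.\<close>

lemma card_hyp_Int3:
  assumes xy: "opposite x y" and xz: "opposite x z" and yz: "opposite y z"
  shows "card (hyp x \<inter> hyp y \<inter> hyp z) = 1"
proof -
  define D m n where "D = (fst x + fst y) * (snd x + snd y)"
    and "m = (fst z + fst y) * (snd z + snd x)" and "n = (fst z + fst x) * (snd z + snd y)"
  have mn: "m \<noteq> 0" "n \<noteq> 0" "D \<noteq> 0"
    using xy xz yz by (auto simp: opposite_def add_eq_0_char2 m_def n_def D_def)
  define P :: "'a mat2 \<Rightarrow> bool" where
    "P = (\<lambda>(a, b, c, d). a = 0 \<and> d = 0 \<and> m * b + n * c = 0)"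
  \<comment> \<open>Interpolation: \<open>(1, fst z)\<close> is a combination of
    \<open>(1, fst x)\<close> and \<open>(1, fst y)\<close>, and likewise for the second
    coordinates, so \<open>xpt z\<close> expands into four rank one matrices.\<close>
  have key: "D * pol2 g (xpt z) = (let (a, b, c, d) = trans x y g in
      (fst z + fst y) * (snd z + snd y) * a + m * b + n * c + (fst z + fst x) * (snd z + snd x) * d)" for g
    by (cases g; cases x; cases y; cases z) (simp add: trans_def m_def n_def D_def poly2)
  have "g \<in> hyp x \<inter> hyp y \<inter> hyp z \<longleftrightarrow> det2 g = 1 \<and> P (trans x y g)" for g
    using key [of g] diag_trans [where x = x and y = y and g = g] mn
    by (cases "trans x y g") (auto simp: hyp_def sl2_def P_def)
  with xy have "trans x y ` (hyp x \<inter> hyp y \<inter> hyp z) = {g. det2 g = D \<and> P g}"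
    unfolding D_def by (rule trans_image)
  also obtain s where s: "s * s = D * n / m" using sq_surj by blast
  have "{g. det2 g = D \<and> P g} = {(0, s, m * s / n, 0)}"
  proof (intro equalityI subsetI)
    fix g assume g: "g \<in> {g. det2 g = D \<and> P g}"
    obtain a b c d where e: "g = (a, b, c, d)" by (cases g)
    have 1: "a = 0" "d = 0" "m * b + n * c = 0" "b * c = D" using g e by (auto simp: P_def)
    have c: "c = m * b / n" using 1(3) mn by (simp add: add_eq_0_char2)
    have "b * b = D * n / m" using 1(4) mn by (simp add: c field_simps)
    then have "b = s" using s sq_inj by metis
    then show "g \<in> {(0, s, m * s / n, 0)}" using 1 c e by simp
  next
    have "s * (m * s / n) = s * s * m / n" by simp
    also have "\<dots> = D" using mn by (simp only: s) (simp add: field_simps)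
    finally show "g \<in> {g. det2 g = D \<and> P g}" if "g \<in> {(0, s, m * s / n, 0)}" for g
      using that mn by (simp add: P_def)
  qed
  finally have "card (trans x y ` (hyp x \<inter> hyp y \<inter> hyp z)) = 1" by simp
  then show ?thesis using inj_trans [OF xy] by (metis card_image inj_on_subset subset_UNIV)
qed

abbreviation conic_hyp :: "'a \<Rightarrow> 'a mat2 set" where "conic_hyp t \<equiv> hyp (t, t)"

text \<open>Its pairing with \<open>xpt (t, r)\<close> is \<open>t + r\<close>, so it is orthogonal
  exactly to the points of the conic \<open>r = t\<close>.\<close>

abbreviation swap2 :: "'a mat2" where "swap2 \<equiv> (0, 1, 1, 0)"

lemma swap2_in_conic_hyp: "swap2 \<in> conic_hyp t"
  by (simp add: hyp_def sl2_def)

lemma conic_hyp_Int3: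
  assumes "t \<noteq> u" "t \<noteq> v" "u \<noteq> v"
  shows "conic_hyp t \<inter> conic_hyp u \<inter> conic_hyp v = {swap2}"
proof -
  have "card (conic_hyp t \<inter> conic_hyp u \<inter> conic_hyp v) = 1"
    using assms by (intro card_hyp_Int3) (auto simp: opposite_def)
  then obtain g where "conic_hyp t \<inter> conic_hyp u \<inter> conic_hyp v = {g}" by (auto simp: card_1_singleton_iff)
  moreover have "swap2 \<in> conic_hyp t \<inter> conic_hyp u \<inter> conic_hyp v" by (simp add: swap2_in_conic_hyp)
  ultimately show ?thesis by (metis singletonD)
qed

lemma int_card_hyp: "int (card (hyp x)) = int CARD('a) ^ 2 - int CARD('a)"
proof -
  obtain n where "CARD('a) = Suc n" using not0_implies_Suc by force
  then show ?thesis by (simp add: card_hyp power2_eq_square algebra_simps)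
qed

lemma int_card_hyp_Int: "opposite x y \<Longrightarrow> int (card (hyp x \<inter> hyp y)) = int CARD('a) - 1"
  by (simp add: card_hyp_Int)

lemma int_card_Un: "int (card (A \<union> B)) = int (card A) + int (card B) - int (card (A \<inter> B))"
  for A B :: "'a mat2 set"
  using card_Un_Int [of A B] by simp

text \<open>Apart from \<open>swap2\<close>, which lies in every \<open>conic_hyp t\<close>, no
  element lies in three of the sets. So inclusion-exclusion on the other elements stops at pairs;
  the summand 1 counts \<open>swap2\<close>.\<close>

lemma card_Union_conic_hyp:
  assumes "finite T" "T \<noteq> {}"
  shows "int (card (\<Union>t\<in>T. conic_hyp t)) =
    1 + int (card T) * (int CARD('a) ^ 2 - int CARD('a) - 1) - int (card T choose 2) * (int CARD('a) - 2)"
  using assms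
proof (induction T rule: finite_ne_induct)
  case (singleton t)
  then show ?case by (simp add: int_card_hyp)
next
  case (insert t T)
  let ?q = "int CARD('a)"
  define H where "H r = conic_hyp t \<inter> conic_hyp r - {swap2}" for r
  have H: "int (card (H r)) = ?q - 2" if "r \<in> T" for r
  proof -
    have "card (conic_hyp t \<inter> conic_hyp r) = CARD('a) - 1"
      using that insert.hyps by (intro card_hyp_Int) (auto simp: opposite_def)
    moreover have "card (H r) = card (conic_hyp t \<inter> conic_hyp r) - 1"
      unfolding H_def using swap2_in_conic_hyp by (intro card_Diff_singleton) auto
    moreover have "card (conic_hyp t \<inter> conic_hyp r) \<noteq> 0"
      using swap2_in_conic_hyp by auto
    ultimately show ?thesis by linarith
  qed
  have "H r \<inter> H r' = {}" if "r \<in> T" "r' \<in> T" "r \<noteq> r'" for r r'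
    using conic_hyp_Int3 [of t r r'] that insert.hyps unfolding H_def by blast
  then have "card (\<Union>r\<in>T. H r) = (\<Sum>r\<in>T. card (H r))"
    using insert.hyps by (intro card_UN_disjoint) auto
  then have UH: "int (card (\<Union>r\<in>T. H r)) = int (card T) * (?q - 2)"
    using H by simp
  have "conic_hyp t \<inter> (\<Union>r\<in>T. conic_hyp r) = insert swap2 (\<Union>r\<in>T. H r)"
    using insert.hyps swap2_in_conic_hyp by (auto simp: H_def)
  then have "int (card (conic_hyp t \<inter> (\<Union>r\<in>T. conic_hyp r))) = 1 + int (card T) * (?q - 2)"
    using UH card_insert_disjoint [of "\<Union>r\<in>T. H r" swap2] by (simp add: H_def)
  moreover have "Suc (card T) choose 2 = card T + (card T choose 2)" by (simp add: numeral_2_eq_2)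
  ultimately show ?case
    using insert.IH insert.hyps int_card_hyp [of "(t, t)"]
    by (simp add: int_card_Un algebra_simps)
qed

text \<open>Since \<open>y\<close> is off the conic, \<open>hyp y\<close> misses
  \<open>swap2\<close>, the only element common to the three \<open>conic_hyp t\<close>. Its traces
  on them have size \<open>q - 1\<close>, meet pairwise in one element and have no common element,
  so they cover \<open>3 * q - 6\<close> elements.\<close>

lemma card_Union_hyp4:
  assumes "card T = 3" and "\<And>t. t \<in> T \<Longrightarrow> opposite (t, t) y" and "fst y \<noteq> snd y"
  shows "int (card (hyp y \<union> (\<Union>t\<in>T. conic_hyp t))) =
    2 + 4 * (int CARD('a) ^ 2 - int CARD('a) - 1) - 6 * (int CARD('a) - 2)"
proof -
  let ?q = "int CARD('a)"
  obtain t u v where T: "T = {t, u, v}" "t \<noteq> u" "t \<noteq> v" "u \<noteq> v"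
    using assms(1) by (auto simp: card_3_iff)
  have op: "opposite (t, t) y" "opposite (u, u) y" "opposite (v, v) y"
    "opposite (t, t) (u, u)" "opposite (t, t) (v, v)" "opposite (u, u) (v, v)"
    using assms T by (auto simp: opposite_def)
  have "swap2 \<notin> hyp y"
    using assms(3) by (cases y) (auto simp: hyp_def add_eq_0_char2)
  then have e: "conic_hyp t \<inter> conic_hyp u \<inter> conic_hyp v \<inter> hyp y = {}"
    using T by (simp add: conic_hyp_Int3)
  define A where "A = hyp y \<inter> conic_hyp t"
  define B where "B = hyp y \<inter> conic_hyp u"
  define C where "C = hyp y \<inter> conic_hyp v"
  have 1: "int (card A) = ?q - 1" "int (card B) = ?q - 1" "int (card C) = ?q - 1"
    unfolding A_def B_def C_def by (simp_all add: op int_card_hyp_Int Int_commute [of "hyp y"])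
  have "A \<inter> B = conic_hyp t \<inter> conic_hyp u \<inter> hyp y" "A \<inter> C = conic_hyp t \<inter> conic_hyp v \<inter> hyp y"
    "B \<inter> C = conic_hyp u \<inter> conic_hyp v \<inter> hyp y"
    unfolding A_def B_def C_def by blast+
  then have 2: "card (A \<inter> B) = 1" "card (A \<inter> C) = 1" "card (B \<inter> C) = 1"
    using op by (simp_all only: card_hyp_Int3)
  have "(A \<union> B) \<inter> C = (A \<inter> C) \<union> (B \<inter> C)" "(A \<inter> C) \<inter> (B \<inter> C) = {}"
    using e unfolding A_def B_def C_def by blast+
  then have "int (card ((A \<union> B) \<inter> C)) = 2" using 2 by (simp add: int_card_Un)
  then have "int (card (A \<union> B \<union> C)) = 3 * ?q - 6" using 1 2 by (simp only: int_card_Un) simp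
  moreover have "hyp y \<inter> (\<Union>t\<in>T. conic_hyp t) = A \<union> B \<union> C"
    unfolding T A_def B_def C_def by blast
  ultimately have "int (card (hyp y \<inter> (\<Union>t\<in>T. conic_hyp t))) = 3 * ?q - 6" by simp
  moreover have "int (card (\<Union>t\<in>T. conic_hyp t)) = 1 + 3 * (?q ^ 2 - ?q - 1) - 3 * (?q - 2)"
    using card_Union_conic_hyp [of T] assms(1) by (simp add: T choose_two)
  ultimately show ?thesis
    by (subst int_card_Un) (simp only: int_card_hyp, simp)
qed

end

section \<open>Alternating matrices\<close>

type_synonym 'a vec4 = "'a \<times> 'a \<times> 'a \<times> 'a"

text \<open>The entries above the diagonal of an alternating \<open>4 \<times> 4\<close> matrix, read row by row.\<close>

type_synonym 'a alt4 = "'a \<times> 'a \<times> 'a \<times> 'a \<times> 'a \<times> 'a"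

fun dot4 :: "'a::field vec4 \<Rightarrow> 'a vec4 \<Rightarrow> 'a" where
  "dot4 (v1, v2, v3, v4) (w1, w2, w3, w4) = v1 * w1 + v2 * w2 + v3 * w3 + v4 * w4"

fun app4 :: "'a::field alt4 \<Rightarrow> 'a vec4 \<Rightarrow> 'a vec4" where
  "app4 (a, b, c, d, e, f) (v1, v2, v3, v4) =
    (a * v2 + b * v3 + c * v4, a * v1 + d * v3 + e * v4, b * v1 + d * v2 + f * v4, c * v1 + e * v2 + f * v3)"

fun pf4 :: "'a::field alt4 \<Rightarrow> 'a" where
  "pf4 (a, b, c, d, e, f) = a * f + b * e + c * d"

text \<open>The Pfaffian adjoint, an inverse up to the scalar \<open>pf4\<close>.\<close>

fun dual4 :: "'a::field alt4 \<Rightarrow> 'a alt4" where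
  "dual4 (a, b, c, d, e, f) = (f, e, d, c, b, a)"

context cubic
begin

section \<open>Points of a hyperplane section orthogonal to a given point\<close>

lemma card_cubic_roots:
  assumes "(a::'a) \<noteq> 0"
  shows "card {x. a * x * x * x + b * x * x + c * x + d = 0} \<le> 3"
proof -
  define P where "P = [:d, c, b, a:]"
  have "{x. a * x * x * x + b * x * x + c * x + d = 0} = {x. poly P x = 0}"
    by (simp add: P_def poly2)
  moreover have "degree P \<le> 3" "P \<noteq> 0"
    using assms by (simp_all add: P_def)
  ultimately show ?thesis
    using card_poly_roots_bound [of P] by simp
qed

lemma card_quadratic_roots:
  assumes "(c::'a) \<noteq> 0"
  shows "card {x. b * x * x + c * x + d = 0} \<le> 2"
proof -
  define P where "P = [:d, c, b:]"
  have "{x. b * x * x + c * x + d = 0} = {x. poly P x = 0}"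
    by (simp add: P_def poly2)
  moreover have "degree P \<le> 2" "P \<noteq> 0"
    using assms by (simp_all add: P_def)
  ultimately show ?thesis
    using card_poly_roots_bound [of P] by simp
qed

text \<open>On the members of \<open>hyp x\<close> with fixed \<open>l\<close>, orthogonality to \<open>p\<close> is a cubic equation in \<open>m\<close>.
  If its leading coefficient vanishes, then the linear one is nonzero for all but at most one \<open>l\<close>.\<close>

lemma card_hyp_perp:
  assumes "pol8 p ((0, 0, 0, 0), xpt x) \<noteq> 0"
  shows "card {g \<in> hyp x. pol8 p (psi g) = 0} \<le> 3 * CARD('a)"
proof -
  obtain t r A B where x: "x = (t, r)" and p: "p = (A, B)" by (cases x; cases p)
  \<comment> \<open>For a matrix in \<open>hyp x\<close> with first row \<open>m, b\<close> put
    \<open>l = m * r + b\<close>. Orthogonality to \<open>xpt x\<close> gives the last entry, and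
    the determinant condition becomes \<open>l * (c + m * t) = 1\<close>; hence every member of
    \<open>hyp x\<close> is some \<open>G l m\<close> with \<open>l \<noteq> 0\<close>.\<close>
  define G where "G l m = (m, l + m * r, m * t + 1 / l, l * t + r * m * t + r / l)" for l m
  define K where "K = pol2 A (veronese (1, t))"
  define c1 where "c1 l = l * l * (1 + \<beta> * r) * K + 1 / l * (1 / l) * cub 1 r * pol2 A (0, 1, 0, t)
    + \<beta> * pol2 B (xpt x)" for l
  define c2 where "c2 l = l * \<beta> * r * r * K + 1 / l * cub 1 r * pol2 A (0, 0, 1, t * t)" for l
  define c0 where "c0 l = pol8 p (psi (G l 0))" for l
  have B: "pol2 B (xpt x) \<noteq> 0" using assms by (cases A; cases B) (simp add: p)
  have pol8_G: "pol8 p (psi (G l m)) = cub 1 r * K * m * m * m + c2 l * m * m + c1 l * m + c0 l" for l m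
  proof -
    define n where "n = 1 / l"
    have "r / l = r * n" by (simp add: n_def)
    then show ?thesis
      unfolding c1_def c2_def c0_def G_def n_def [symmetric]
      by (cases A; cases B) (simp add: p x psi_def curve_def M0_def K_def cub_def poly2)
  qed
  define R where "R l = {m. pol8 p (psi (G l m)) = 0}" for l
  have sub: "{g \<in> hyp x. pol8 p (psi g) = 0} \<subseteq> (\<Union>l\<in>UNIV - {0}. G l ` R l)"
  proof
    fix g assume g: "g \<in> {g \<in> hyp x. pol8 p (psi g) = 0}"
    obtain a b c d where e: "g = (a, b, c, d)" by (cases g)
    have "a * d + b * c = 1" "d + (a * t * r + b * t + c * r) = 0"
      using g by (simp_all add: e x hyp_def sl2_def poly2)
    then have 1: "a * d + b * c = 1" "d = a * t * r + b * t + c * r"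
      by (simp_all only: add_eq_0_char2)
    define l where "l = a * r + b"
    have "l * (c + a * t) = a * d + b * c"
      unfolding 1(2) l_def by (simp add: poly2)
    then have 2: "l * (c + a * t) = 1" using 1 by simp
    then have l: "l \<noteq> 0" by auto
    have 3: "1 / l = c + a * t" using 2 l by (simp add: field_simps)
    have "r / l = r * (c + a * t)" by (simp flip: 3)
    then have "g = G l a"
      unfolding G_def e 3 by (simp add: l_def 1(2) poly2)
    then show "g \<in> (\<Union>l\<in>UNIV - {0}. G l ` R l)"
      using l g by (auto simp: R_def)
  qed
  \<comment> \<open>Only for these \<open>l\<close> can every \<open>m\<close> be a solution. There
    a multiple of \<open>(1 / l)^2\<close> equals a fixed nonzero constant, so injectivity of
    squaring leaves at most one.\<close>
  define bad where "bad = {l. l \<noteq> 0 \<and> K = 0 \<and> c1 l = 0}"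
  have "l = l'" if "l \<in> bad" "l' \<in> bad" for l l'
  proof -
    define L where "L = cub 1 r * pol2 A (0, 1, 0, t)"
    have *: "1 / l * (1 / l) * L = \<beta> * pol2 B (xpt x)" "1 / l' * (1 / l') * L = \<beta> * pol2 B (xpt x)"
      using that by (auto simp: bad_def c1_def L_def add_eq_0_char2)
    moreover have "L \<noteq> 0" using *(1) B by auto
    ultimately have "1 / l * (1 / l) = 1 / l' * (1 / l')" by (metis mult_cancel_right)
    then show ?thesis using sq_inj by (metis divide_divide_eq_right div_by_1 mult_1)
  qed
  then have bad: "card bad \<le> 1" using card_le_Suc0_iff_eq [of bad] by auto
  have R: "card (R l) \<le> (if K = 0 then 2 + (if l \<in> bad then CARD('a) else 0) else 3)" if "l \<noteq> 0" for l
  proof (cases "K = 0")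
    case False
    then show ?thesis
      using card_cubic_roots [of "cub 1 r * K"] by (simp add: R_def pol8_G cub_eq_0_iff)
  next
    case True
    show ?thesis
    proof (cases "c1 l = 0")
      case True
      then show ?thesis using \<open>K = 0\<close> that card_mono [of UNIV "R l"] by (simp add: bad_def)
    next
      case False
      then show ?thesis using \<open>K = 0\<close> card_quadratic_roots [of "c1 l"] by (simp add: R_def pol8_G bad_def)
    qed
  qed
  have "card {g \<in> hyp x. pol8 p (psi g) = 0} \<le> card (\<Union>l\<in>UNIV - {0}. G l ` R l)"
    by (rule card_mono [OF _ sub]) simp
  also have "\<dots> \<le> (\<Sum>l\<in>UNIV - {0}. card (G l ` R l))" by (rule card_UN_le) simp
  also have "\<dots> \<le> (\<Sum>l\<in>UNIV - {0}. if K = 0 then 2 + (if l \<in> bad then CARD('a) else 0) else 3)"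
    by (intro sum_mono order.trans [OF card_image_le R]) auto
  also have "\<dots> \<le> 3 * CARD('a)"
  proof (cases "K = 0")
    case True
    \<comment> \<open>The exceptional \<open>l\<close> may contribute all \<open>q\<close> values of
      \<open>m\<close>; the total \<open>2 * (q - 1) + q\<close> is still below
      \<open>3 * q\<close>.\<close>
    have "(\<Sum>l\<in>UNIV - {0}. if l \<in> bad then CARD('a) else 0) = card bad * CARD('a)"
    proof -
      have "(UNIV - {0}) \<inter> bad = bad" by (auto simp: bad_def)
      then show ?thesis by (simp add: sum.If_cases)
    qed
    also have "\<dots> \<le> CARD('a)" using bad by simp
    finally have "(\<Sum>l\<in>UNIV - {0}. 2 + (if l \<in> bad then CARD('a) else 0)) \<le> 2 * (CARD('a) - 1) + CARD('a)"
      by (simp only: sum.distrib) (simp add: card_Diff_singleton)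
    then show ?thesis using True by simp
  qed simp
  finally show ?thesis .
qed

section \<open>Kernels and Pfaffians of alternating matrices\<close>

lemma app4_add: "app4 (M + N) v = app4 M v + app4 N (v :: 'a vec4)"
  by (cases M; cases N; cases v) (simp add: poly2)

lemma app4_vec_add: "app4 M (v + w) = app4 M v + app4 M (w :: 'a vec4)"
  by (cases M; cases v; cases w) (simp add: poly2)

lemma app4_smul4: "app4 M (smul4 k v) = smul4 k (app4 M (v :: 'a vec4))"
  by (cases M; cases v) (simp add: poly2)

lemma dot4_app4: "dot4 v (app4 M v) = (0 :: 'a)"
  by (cases M; cases v) (simp add: poly2)

lemma dot4_app4_commute: "dot4 v (app4 M w) = dot4 w (app4 M v :: 'a vec4)"
  by (cases M; cases v; cases w) (simp add: poly2)

lemma dual4_app4: "app4 (dual4 M) (app4 M v) = smul4 (pf4 M) (v :: 'a vec4)"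
  by (cases M; cases v) (simp add: poly2)

lemma app4_dual4: "app4 M (app4 (dual4 M) v) = smul4 (pf4 M) (v :: 'a vec4)"
  by (cases M; cases v) (simp add: poly2)

lemma vec4_add_self: "v + v = (0 :: 'a vec4)"
  by (cases v) (simp add: zero_prod_def)

lemma app4_eq_0:
  assumes "pf4 M \<noteq> 0" "app4 M v = 0" shows "v = (0 :: 'a vec4)"
  using dual4_app4 [of M v] assms by (cases M; cases v) (auto simp: zero_prod_def)

text \<open>The rank is at least 2: if the entry at \<open>(i, j)\<close> is nonzero, a kernel
  vector is determined by its other two coordinates.\<close>

lemma card_ker_app4:
  assumes "M \<noteq> (0 :: 'a alt4)"
  shows "card {v. app4 M v = 0} \<le> CARD('a) ^ 2"
proof -
  have *: ?thesis if "inj_on f {v. app4 M v = 0}" for f :: "'a vec4 \<Rightarrow> 'a \<times> 'a"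
    using card_inj_on_le [OF that, of UNIV] by (simp add: power2_eq_square)
  have z: "app4 M v = app4 M v' \<Longrightarrow> app4 M (v + v') = 0" for v v'
    by (simp add: app4_vec_add vec4_add_self)
  have inj: "inj_on f {v. app4 M v = 0}"
    if "\<And>v w. f (v + w) = f v + f w" "\<And>v. app4 M v = 0 \<Longrightarrow> f v = 0 \<Longrightarrow> v = 0" for f :: "'a vec4 \<Rightarrow> 'a \<times> 'a"
  proof (rule inj_onI)
    fix v w assume "v \<in> {v. app4 M v = 0}" "w \<in> {v. app4 M v = 0}" "f v = f w"
    moreover have "f w + f w = 0" by (cases "f w") (simp add: zero_prod_def)
    ultimately have "v + w = 0" using that by (simp add: app4_vec_add)
    then show "v = w" by (metis vec4_add_self add_right_cancel)
  qed
  obtain a b c d e f where M: "M = (a, b, c, d, e, f)" by (cases M)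
  consider "a \<noteq> 0" | "b \<noteq> 0" | "c \<noteq> 0" | "d \<noteq> 0" | "e \<noteq> 0" | "f \<noteq> 0"
    using assms by (auto simp: M zero_prod_def)
  then show ?thesis
  proof cases
    case 1 then show ?thesis
      by (intro * [of "\<lambda>(v1, v2, v3, v4). (v3, v4)"] inj) (auto simp: M zero_prod_def split: prod.splits)
  next
    case 2 then show ?thesis
      by (intro * [of "\<lambda>(v1, v2, v3, v4). (v2, v4)"] inj) (auto simp: M zero_prod_def split: prod.splits)
  next
    case 3 then show ?thesis
      by (intro * [of "\<lambda>(v1, v2, v3, v4). (v2, v3)"] inj) (auto simp: M zero_prod_def split: prod.splits)
  next
    case 4 then show ?thesis
      by (intro * [of "\<lambda>(v1, v2, v3, v4). (v1, v4)"] inj) (auto simp: M zero_prod_def split: prod.splits)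
  next
    case 5 then show ?thesis
      by (intro * [of "\<lambda>(v1, v2, v3, v4). (v1, v3)"] inj) (auto simp: M zero_prod_def split: prod.splits)
  next
    case 6 then show ?thesis
      by (intro * [of "\<lambda>(v1, v2, v3, v4). (v1, v2)"] inj) (auto simp: M zero_prod_def split: prod.splits)
  qed
qed

lemma card_dot4_eq_0:
  assumes "v \<noteq> (0 :: 'a vec4)"
  shows "card {w. dot4 v w = 0} \<le> CARD('a) ^ 3"
proof -
  have *: ?thesis if "\<And>w. dot4 v w = 0 \<Longrightarrow> f w = 0 \<Longrightarrow> w = 0" "\<And>w w'. f (w + w') = f w + f w'"
    for f :: "'a vec4 \<Rightarrow> 'a \<times> 'a \<times> 'a"
  proof -
    have "inj_on f {w. dot4 v w = 0}"
    proof (rule inj_onI)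
      fix w w' assume w: "w \<in> {w. dot4 v w = 0}" "w' \<in> {w. dot4 v w = 0}" "f w = f w'"
      have "f w' + f w' = 0" by (cases "f w'") (simp add: zero_prod_def)
      moreover have "dot4 v (w + w') = dot4 v w + dot4 v w'"
        by (cases v; cases w; cases w') (simp add: poly2)
      ultimately have "w + w' = 0" using w that by simp
      then show "w = w'" by (metis vec4_add_self add_right_cancel)
    qed
    then show ?thesis using card_inj_on_le [of f _ UNIV] by (simp add: power3_eq_cube mult.assoc)
  qed
  obtain v1 v2 v3 v4 where v: "v = (v1, v2, v3, v4)" by (cases v)
  consider "v1 \<noteq> 0" | "v2 \<noteq> 0" | "v3 \<noteq> 0" | "v4 \<noteq> 0"
    using assms by (auto simp: v zero_prod_def)
  then show ?thesis
  proof cases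
    case 1 then show ?thesis
      by (intro * [of "\<lambda>(w1, w2, w3, w4). (w2, w3, w4)"]) (auto simp: v zero_prod_def)
  next
    case 2 then show ?thesis
      by (intro * [of "\<lambda>(w1, w2, w3, w4). (w1, w3, w4)"]) (auto simp: v zero_prod_def)
  next
    case 3 then show ?thesis
      by (intro * [of "\<lambda>(w1, w2, w3, w4). (w1, w2, w4)"]) (auto simp: v zero_prod_def)
  next
    case 4 then show ?thesis
      by (intro * [of "\<lambda>(w1, w2, w3, w4). (w1, w2, w3)"]) (auto simp: v zero_prod_def)
  qed
qed

text \<open>The graphs of \<open>Z\<close>, together with \<open>{0} \<times> F\<^sup>4\<close>, form a spread. So they partition the nonzero vectors
  of the graph of \<open>N\<close>, and each meets it in at most \<open>q\<^sup>2 - 1\<close> of them.\<close>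

lemma card_meeting_alt4:
  fixes Z :: "'a alt4 set"
  assumes card: "card Z = CARD('a) ^ 3"
    and pf: "\<And>M N. M \<in> Z \<Longrightarrow> N \<in> Z \<Longrightarrow> M \<noteq> N \<Longrightarrow> pf4 (M + N) \<noteq> 0"
    and N: "N \<notin> Z"
  shows "CARD('a) ^ 2 + 1 \<le> card {M \<in> Z. pf4 (M + N) = 0}"
proof -
  let ?q = "CARD('a)" and ?Y = "{M \<in> Z. pf4 (M + N) = 0}"
  have alt_add_self: "M + M = 0" for M :: "'a alt4" by (cases M) (simp add: zero_prod_def)
  have cover: "\<exists>M\<in>?Y. app4 (M + N) v = 0" if v: "v \<noteq> 0" for v
  proof -
    \<comment> \<open>The \<open>q^3\<close> vectors \<open>app4 M v\<close> are distinct and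
      orthogonal to \<open>v\<close>, so they exhaust that hyperplane, which also contains
      \<open>app4 N v\<close>.\<close>
    have "inj_on (\<lambda>M. app4 M v) Z"
    proof (rule inj_onI, rule ccontr)
      fix M M' assume M: "M \<in> Z" "M' \<in> Z" "app4 M v = app4 M' v" "M \<noteq> M'"
      then have "app4 (M + M') v = 0" by (simp add: app4_add vec4_add_self)
      then show False using pf M v app4_eq_0 by blast
    qed
    then have "card ((\<lambda>M. app4 M v) ` Z) = ?q ^ 3" by (simp add: card_image card)
    moreover have "(\<lambda>M. app4 M v) ` Z \<subseteq> {w. dot4 v w = 0}" by (auto simp: dot4_app4)
    ultimately have "(\<lambda>M. app4 M v) ` Z = {w. dot4 v w = 0}"
      using card_dot4_eq_0 [OF v] by (intro card_seteq) auto
    then have "app4 N v \<in> (\<lambda>M. app4 M v) ` Z" by (simp add: dot4_app4)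
    then obtain M where M: "M \<in> Z" "app4 N v = app4 M v" by blast
    then have "app4 (M + N) v = 0" by (simp add: app4_add vec4_add_self)
    then show ?thesis using M v app4_eq_0 by blast
  qed
  have "?q ^ 4 - 1 = card (UNIV - {0 :: 'a vec4})"
    by (simp add: card_Diff_singleton power4_eq_xxxx mult.assoc)
  also have "\<dots> \<le> card (\<Union>M\<in>?Y. {v. app4 (M + N) v = 0} - {0})"
    using cover by (intro card_mono) auto
  also have "\<dots> \<le> (\<Sum>M\<in>?Y. card ({v. app4 (M + N) v = 0} - {0}))" by (rule card_UN_le) simp
  also have "\<dots> \<le> (\<Sum>M\<in>?Y. ?q ^ 2 - 1)"
  proof (rule sum_mono)
    fix M assume "M \<in> ?Y"
    then have "M + N \<noteq> 0" using N alt_add_self by (metis (lifting) add_right_cancel mem_Collect_eq)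
    then have "card {v. app4 (M + N) v = 0} \<le> ?q ^ 2" by (rule card_ker_app4)
    moreover have "0 \<in> {v. app4 (M + N) v = 0}" by (cases "M + N") (simp add: zero_prod_def)
    ultimately show "card ({v. app4 (M + N) v = 0} - {0}) \<le> ?q ^ 2 - 1"
      by (simp add: card_Diff_singleton)
  qed
  also have "\<dots> = card ?Y * (?q ^ 2 - 1)" by simp
  finally have *: "?q ^ 4 - 1 \<le> card ?Y * (?q ^ 2 - 1)" .
  have "?q > 1" using card_mono [of UNIV "{0 :: 'a, 1}"] by simp
  then have "?q ^ 2 > 1" by (rule one_less_power) simp
  then obtain n where n: "?q ^ 2 = Suc n" "n > 0" by (cases "?q ^ 2") auto
  have "?q ^ 4 - 1 = (?q ^ 2 + 1) * (?q ^ 2 - 1)"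
    using n by (simp add: power4_eq_xxxx power2_eq_square [symmetric] algebra_simps) 
  then have "(?q ^ 2 + 1) * (?q ^ 2 - 1) \<le> card ?Y * (?q ^ 2 - 1)" using * by simp
  then show ?thesis using n by (simp only: mult_le_cancel2)
qed

end

section \<open>Switching in the ovoid\<close>

fun smul6 :: "'a::field \<Rightarrow> 'a alt4 \<Rightarrow> 'a alt4" where
  "smul6 k (a, b, c, d, e, f) = (k * a, k * b, k * c, k * d, k * e, k * f)"

text \<open>A partial spread containing \<open>{0} \<times> F\<^sup>4\<close> consists of that subspace and of graphs of alternating
  matrices; this is maximality in terms of the matrices.\<close>

definition maximal_alt_spread :: "'a::field alt4 set \<Rightarrow> bool" where
  "maximal_alt_spread Z \<longleftrightarrow>
    (\<forall>M\<in>Z. \<forall>N\<in>Z. M \<noteq> N \<longrightarrow> pf4 (M + N) \<noteq> 0) \<and> (\<forall>N. \<exists>M\<in>Z. pf4 (M + N) = 0)"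

context cubic
begin

text \<open>\<open>altm p\<close> lists the coordinates of the projection of \<open>p\<close> to the orthogonal complement of the
  hyperbolic pair \<open>psi one2\<close>, \<open>((0, 0, 0, 1), 0)\<close>, on which the form becomes the Pfaffian.\<close>

definition wt :: "'a mat2 \<times> 'a mat2 \<Rightarrow> 'a" where "wt p = pol8 p (psi one2)"

fun altm :: "'a mat2 \<times> 'a mat2 \<Rightarrow> 'a alt4" where
  "altm ((a, b, c, d), (a', b', c', d')) = (a + b, a' + a, b', \<beta> * c', \<beta> * (d' + a), c)"

text \<open>Scaling to \<open>wt p = 1\<close> makes the matrix depend only on the projective
  point.\<close>

definition nalt :: "'a mat2 \<times> 'a mat2 \<Rightarrow> 'a alt4" where
  "nalt p = smul6 (1 / wt p) (altm p)"

lemma wt_eq: "wt ((a, b, c, d), (a', b', c', d')) = \<beta> * a + c + d + \<beta> * (a' + d')"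
  by (simp add: wt_def psi_def curve_def M0_def poly2)

text \<open>The polar form of \<open>p\<close> with the two vectors of the hyperbolic pair is
  \<open>wt p\<close> and \<open>fst (fst p)\<close>, and projecting changes the quadratic form by
  their product. The right-hand side is the projected form at the combination of \<open>p\<close>
  and \<open>p'\<close>.\<close>

lemma pf4_altm:
  "pf4 (smul6 k (altm p) + smul6 l (altm p')) =
    k * k * (quad8 p + fst (fst p) * wt p) + l * l * (quad8 p' + fst (fst p') * wt p')
    + k * l * (pol8 p p' + fst (fst p) * wt p' + fst (fst p') * wt p)"
proof -
  obtain a b c d a' b' c' d' where p: "p = ((a, b, c, d), (a', b', c', d'))" by (metis prod.exhaust)
  obtain e f g h e' f' g' h' where p': "p' = ((e, f, g, h), (e', f', g', h'))" by (metis prod.exhaust)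
  show ?thesis by (simp add: p p' wt_eq poly2)
qed

lemma pf4_nalt:
  assumes "quad8 p = 0" "quad8 p' = 0" "wt p \<noteq> 0" "wt p' \<noteq> 0"
  shows "pf4 (nalt p + nalt p') = pol8 p p' / (wt p * wt p')"
proof -
  define k l where "k = 1 / wt p" and "l = 1 / wt p'"
  have kl: "k * wt p = 1" "l * wt p' = 1" using assms by (simp_all add: k_def l_def)
  have "pf4 (nalt p + nalt p') = k * (k * wt p) * fst (fst p) + l * (l * wt p') * fst (fst p')
      + (k * l * pol8 p p' + k * (l * wt p') * fst (fst p) + l * (k * wt p) * fst (fst p'))"
    unfolding nalt_def k_def [symmetric] l_def [symmetric] pf4_altm assms by (simp add: poly2)
  also have "\<dots> = k * l * pol8 p p'" unfolding kl by (simp add: poly2)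
  finally show ?thesis by (simp add: k_def l_def)
qed

lemma ex_nalt: "\<exists>p. quad8 p = 0 \<and> wt p = 1 \<and> nalt p = N"
proof -
  obtain a b c d e f where N: "N = (a, b, c, d, e, f)" by (cases N)
  define P where "P = pf4 N"
  define d1 where "d1 = d / \<beta>"
  define e1 where "e1 = e / \<beta>"
  \<comment> \<open>\<open>P\<close> is the coordinate along \<open>psi one2\<close>, on which
    \<open>altm\<close> vanishes. Since \<open>wt p = 1\<close>, the correction term is
    \<open>P\<close>, so taking \<open>P = pf4 N\<close> makes \<open>p\<close> singular.\<close>
  define p where "p = ((P, a + P, f, 1 + \<beta> * P + f + \<beta> * (b + P + (e1 + P))), (b + P, c, d1, e1 + P))"
  have 1: "d = \<beta> * d1" "e = \<beta> * e1" by (simp_all add: d1_def e1_def)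
  have w: "wt p = 1" unfolding p_def wt_eq by (simp add: poly2)
  have al: "altm p = N" unfolding p_def N 1 by (simp add: poly2)
  have "pf4 N = quad8 p + P * wt p"
    using pf4_altm [of 1 p 0 p] by (simp add: al w) (simp add: N p_def zero_prod_def)
  then have "quad8 p = 0" by (simp add: w P_def)
  moreover have "nalt p = N" by (simp add: nalt_def al w) (simp add: N)
  ultimately show ?thesis using w by blast
qed

text \<open>The condition \<open>fst x * snd x \<noteq> 1\<close> keeps \<open>one2\<close> out of
  \<open>hyp x\<close>, so that \<open>psi one2\<close> survives the switching and can stand for
  \<open>{0} \<times> F^4\<close>.\<close>

definition config :: "('a \<times> 'a) set \<Rightarrow> bool" where
  "config X \<longleftrightarrow> X \<noteq> {} \<and> (\<forall>x\<in>X. fst x * snd x \<noteq> 1) \<and> (\<forall>x\<in>X. \<forall>y\<in>X. x \<noteq> y \<longrightarrow> opposite x y)"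

definition pt :: "'a \<times> 'a \<Rightarrow> 'a mat2 \<times> 'a mat2" where
  "pt x = ((0, 0, 0, 0), xpt x)"

text \<open>No \<open>sig u\<close> is kept, as each is orthogonal to every
  \<open>pt x\<close>.\<close>

definition switched :: "('a \<times> 'a) set \<Rightarrow> ('a mat2 \<times> 'a mat2) set" where
  "switched X = psi ` (sl2 - (\<Union>x\<in>X. hyp x)) \<union> pt ` X"

lemma pol8_psi_pt: "pol8 (psi g) (pt x) = \<beta> * pol2 g (xpt x)"
  by (cases "curve g") (simp add: psi_def pt_def)

lemma pol8_pt_pt: "pol8 (pt x) (pt y) = \<beta> * pol2 (xpt x) (xpt y)"
  by (simp add: pt_def)

lemma pol8_sig_pt: "pol8 (sig u) (pt x) = 0"
  by (cases u; cases x) (simp add: sig_def pt_def)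

lemma quad8_switched:
  assumes "z \<in> switched X" shows "quad8 z = 0"
proof -
  consider "z \<in> omega" | x where "z = pt x"
    using assms unfolding switched_def omega_def by blast
  then show ?thesis
  proof cases
    case 2 then show ?thesis by (cases x) (simp add: pt_def poly2)
  qed (rule quad8_omega)
qed

lemma pol8_switched:
  assumes "config X" "z \<in> switched X" "z' \<in> switched X" "pol8 z z' = 0"
  shows "z = z'"
proof -
  have psi: "pol8 (psi g) (psi h) \<noteq> 0 \<or> psi g = psi h" if "g \<in> sl2" "h \<in> sl2" for g h
    using that pol8_psi_eq_0 by blast
  have psi_pt: "pol8 (psi g) (pt x) \<noteq> 0" "pol8 (pt x) (psi g) \<noteq> 0" if "g \<in> sl2" "g \<notin> hyp x" for g x
    using that by (simp_all add: pol8_psi_pt pol8_commute [of "pt x"] hyp_def)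
  have pt: "pol8 (pt x) (pt y) \<noteq> 0 \<or> x = y" if "x \<in> X" "y \<in> X" for x y
  proof (cases "x = y")
    case False
    then have "opposite x y" using that assms(1) unfolding config_def by blast
    then show ?thesis by (simp add: pol8_pt_pt pol2_xpt_eq_0_iff)
  qed simp
  consider g where "z = psi g" "g \<in> sl2" "\<And>x. x \<in> X \<Longrightarrow> g \<notin> hyp x" | x where "z = pt x" "x \<in> X"
    using assms(2) unfolding switched_def by blast
  note z = this
  consider g where "z' = psi g" "g \<in> sl2" "\<And>x. x \<in> X \<Longrightarrow> g \<notin> hyp x" | x where "z' = pt x" "x \<in> X"
    using assms(3) unfolding switched_def by blast
  note z' = this
  show ?thesis
  proof (cases rule: z)
    case (1 g)
    then show ?thesis by (cases rule: z') (metis assms(4) psi, metis assms(4) psi_pt(1))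
  next
    case (2 x)
    then show ?thesis by (cases rule: z') (metis assms(4) psi_pt(2), metis assms(4) pt)
  qed
qed

lemma one2_switched: "config X \<Longrightarrow> psi one2 \<in> switched X"
proof -
  have "one2 \<in> sl2" by (simp add: sl2_def)
  moreover assume "config X"
  then have "one2 \<notin> hyp x" if "x \<in> X" for x
    using that by (cases x) (auto simp: config_def hyp_def add_eq_0_char2)
  ultimately show ?thesis by (auto simp: switched_def)
qed

lemma card_switched:
  "int (card (switched X)) = int CARD('a) ^ 3 - int CARD('a) - int (card (\<Union>x\<in>X. hyp x)) + int (card X)"
proof -
  have "inj psi" "inj pt" by (auto simp: inj_def psi_def pt_def)
  then have i: "inj_on psi S" "inj_on pt X" for S by (auto intro: inj_on_subset)
  have "psi g \<noteq> pt x" if "g \<in> sl2" for g x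
  proof
    assume "psi g = pt x"
    then have "det2 g = 0" by (cases x) (auto simp: psi_def pt_def mult.commute)
    then show False using that by (simp add: sl2_def)
  qed
  then have "psi ` (sl2 - (\<Union>x\<in>X. hyp x)) \<inter> pt ` X = {}"
    unfolding disjoint_iff by (metis (no_types, lifting) DiffD1 imageE)
  then have "card (switched X) = card (sl2 - (\<Union>x\<in>X. hyp x)) + card X"
    unfolding switched_def by (simp add: card_Un_disjoint card_image i)
  moreover have "(\<Union>x\<in>X. hyp x) \<subseteq> sl2" by (auto simp: hyp_def)
  then have "int (card (sl2 - (\<Union>x\<in>X. hyp x))) = int (card sl2) - int (card (\<Union>x\<in>X. hyp x))"
    by (simp add: card_Diff_subset card_mono of_nat_diff)
  moreover have "int (card sl2) = int CARD('a) ^ 3 - int CARD('a)"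
    using card_sl2 by (metis add_diff_cancel_right' of_nat_add of_nat_power)
  ultimately show ?thesis by simp
qed

lemma nalt_inj_on:
  assumes "\<And>z. z \<in> S \<Longrightarrow> quad8 z = 0 \<and> wt z \<noteq> 0"
    and "\<And>z z'. z \<in> S \<Longrightarrow> z' \<in> S \<Longrightarrow> pol8 z z' = 0 \<Longrightarrow> z = z'"
  shows "inj_on nalt S"
proof (rule inj_onI)
  fix z z' assume z: "z \<in> S" "z' \<in> S" "nalt z = nalt z'"
  have "pf4 (nalt z + nalt z') = 0" using pf4_nalt [of z z] assms(1) z by (metis pol8_self div_0)
  then have "pol8 z z' = 0" using pf4_nalt [of z z'] assms(1) z by simp
  then show "z = z'" using assms z by blast
qed

lemma switched_blocking:
  assumes X: "config X" and card: "3 * card X + 1 < CARD('a)"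
    and p: "quad8 p = 0" "wt p \<noteq> 0"
  shows "\<exists>z\<in>switched X. pol8 p z = 0"
proof (rule ccontr)
  assume "\<not> ?thesis"
  then have no: "pol8 p z \<noteq> 0" if "z \<in> switched X" for z using that by blast
  let ?q = "CARD('a)"
  define O' where "O' = omega - {psi one2}"
  have one: "psi one2 \<in> omega" by (simp add: omega_def sl2_def)
  have O': "quad8 z = 0" "wt z \<noteq> 0" if "z \<in> O'" for z
    using that quad8_omega pol8_omega [OF _ one] unfolding O'_def wt_def by blast+
  have on: "(\<exists>u. z = sig u) \<or> (\<exists>x\<in>X. \<exists>g\<in>hyp x. z = psi g)" if "z \<in> omega" "pol8 p z = 0" for z
    using no [of z] that unfolding omega_def switched_def by blast
  have ne: "z = z'" if "z \<in> O'" "z' \<in> O'" "pol8 z z' = 0" for z z'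
    using that pol8_omega unfolding O'_def by blast
  have inj: "inj_on nalt O'"
    using O' ne by (intro nalt_inj_on) blast+
  have pol: "pf4 (nalt z + nalt p) = 0 \<longleftrightarrow> pol8 p z = 0" if "z \<in> O'" for z
    using pf4_nalt [of z p] O' [OF that] p by (simp add: pol8_commute)
  have cO: "card (nalt ` O') = ?q ^ 3"
    using card_omega one by (simp add: card_image [OF inj]) (simp add: O'_def)
  \<comment> \<open>Here \<open>p\<close> may represent a point of the ovoid itself. That point was
    removed, so it is orthogonal to some \<open>pt x\<close>; then so is \<open>p\<close>.\<close>
  have nO: "nalt p \<notin> nalt ` O'"
  proof
    assume "nalt p \<in> nalt ` O'"
    then obtain z where z: "z \<in> O'" "nalt p = nalt z" by blast
    have tr: "pol8 p y = 0" if "pol8 z y = 0" "quad8 y = 0" "wt y \<noteq> 0" for y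
      using pf4_nalt [of p y] pf4_nalt [of z y] that p O' [OF z(1)] z(2) by simp
    have "pol8 p z = 0" using tr pol8_self O' z by blast
    then obtain x where x: "x \<in> X" "pol8 z (pt x) = 0"
    proof -
      have "z \<in> omega" using z by (simp add: O'_def)
      with \<open>pol8 p z = 0\<close> consider u where "z = sig u" | x g where "x \<in> X" "g \<in> hyp x" "z = psi g"
        using on by blast
      then show ?thesis
      proof cases
        case 1
        obtain x where "x \<in> X" using X by (auto simp: config_def)
        then show ?thesis using that 1 pol8_sig_pt by blast
      qed (use that in \<open>auto simp: hyp_def pol8_psi_pt\<close>)
    qed
    have "pt x \<in> switched X" using x by (simp add: switched_def)
    moreover from this have "wt (pt x) \<noteq> 0"
      using pol8_switched [OF X _ one2_switched [OF X]] x(2) O'(2) [OF z(1)] unfolding wt_def by metis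
    ultimately show False using no tr x(2) quad8_switched by blast
  qed
  have "pf4 (M + N) \<noteq> 0" if "M \<in> nalt ` O'" "N \<in> nalt ` O'" "M \<noteq> N" for M N
  proof -
    from that obtain z z' where z: "z \<in> O'" "z' \<in> O'" "M = nalt z" "N = nalt z'" "z \<noteq> z'" by blast
    then have "pol8 z z' \<noteq> 0" using ne by blast
    then show ?thesis using pf4_nalt [of z z'] O' z by simp
  qed
  then have "?q ^ 2 + 1 \<le> card {M \<in> nalt ` O'. pf4 (M + nalt p) = 0}"
    by (rule card_meeting_alt4 [OF cO _ nO])
  also have "{M \<in> nalt ` O'. pf4 (M + nalt p) = 0} = nalt ` {z \<in> O'. pol8 p z = 0}"
    using pol by blast
  also have "card \<dots> \<le> card {z \<in> O'. pol8 p z = 0}" by (rule card_image_le) simp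
  also have "\<dots> \<le> card (sig ` subline \<union> (\<Union>x\<in>X. psi ` {g \<in> hyp x. pol8 p (psi g) = 0}))"
  proof (rule card_mono)
    have sig: "z \<in> sig ` subline" if "z \<in> omega" "z = sig u" for z u
      using that by (auto simp: omega_def psi_def sig_def sl2_def)
    show "{z \<in> O'. pol8 p z = 0} \<subseteq> sig ` subline \<union> (\<Union>x\<in>X. psi ` {g \<in> hyp x. pol8 p (psi g) = 0})"
    proof
      fix z assume "z \<in> {z \<in> O'. pol8 p z = 0}"
      then have z: "z \<in> omega" "pol8 p z = 0" by (simp_all add: O'_def)
      then consider u where "z = sig u" | x g where "x \<in> X" "g \<in> hyp x" "z = psi g"
        using on by blast
      then show "z \<in> sig ` subline \<union> (\<Union>x\<in>X. psi ` {g \<in> hyp x. pol8 p (psi g) = 0})"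
      proof cases
        case 1
        then show ?thesis using sig z(1) by (intro UnI1)
      next
        case 2
        then show ?thesis using z(2) by (intro UnI2 UN_I [of x] image_eqI [of _ _ g]) simp_all
      qed
    qed
  qed simp
  also have "\<dots> \<le> card (sig ` subline) + card (\<Union>x\<in>X. psi ` {g \<in> hyp x. pol8 p (psi g) = 0})"
    by (rule card_Un_le)
  also have "\<dots> \<le> card subline + (\<Sum>x\<in>X. card (psi ` {g \<in> hyp x. pol8 p (psi g) = 0}))"
    by (intro add_mono card_image_le card_UN_le) simp_all
  also have "\<dots> \<le> (?q + 1) + (\<Sum>x\<in>X. 3 * ?q)"
  proof (intro add_mono sum_mono)
    fix x assume "x \<in> X"
    then have "pol8 p (pt x) \<noteq> 0" using no by (simp add: switched_def)
    then have "card {g \<in> hyp x. pol8 p (psi g) = 0} \<le> 3 * ?q"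
      unfolding pt_def by (rule card_hyp_perp)
    then show "card (psi ` {g \<in> hyp x. pol8 p (psi g) = 0}) \<le> 3 * ?q"
      by (rule order.trans [OF card_image_le [OF finite]])
  qed (simp add: card_subline)
  also have "\<dots> = ?q * (3 * card X + 1) + 1" by simp
  finally have "?q * ?q \<le> ?q * (3 * card X + 1)" by (simp add: power2_eq_square)
  moreover have "?q * (3 * card X + 1) < ?q * ?q" using card by (intro mult_strict_left_mono) simp_all
  ultimately show False by linarith
qed

text \<open>The point \<open>psi one2\<close> corresponds to \<open>{0} \<times> F^4\<close> and not
  to a matrix, whence the difference 1 in size. Every matrix comes from a singular point by
  \<open>ex_nalt\<close>, to which \<open>switched_blocking\<close> applies.\<close>

lemma ex_maximal_alt_spread:
  assumes X: "config X" and card: "3 * card X + 1 < CARD('a)"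
  shows "\<exists>Z. int (card Z) + 1 = int (card (switched X)) \<and> maximal_alt_spread (Z :: 'a alt4 set)"
proof -
  define S where "S = switched X - {psi one2}"
  have one: "psi one2 \<in> switched X" using one2_switched X .
  have S: "quad8 z = 0" "wt z \<noteq> 0" if "z \<in> S" for z
    using that quad8_switched pol8_switched [OF X _ one] unfolding S_def wt_def by blast+
  have ne: "z = z'" if "z \<in> S" "z' \<in> S" "pol8 z z' = 0" for z z'
    using that pol8_switched [OF X] by (auto simp: S_def)
  have inj: "inj_on nalt S" using S ne by (intro nalt_inj_on) blast+
  have "int (card (nalt ` S)) + 1 = int (card (switched X))"
    using one card_gt_0_iff [of "switched X"] by (auto simp: card_image [OF inj]) (auto simp: S_def)
  moreover have "\<exists>M\<in>nalt ` S. pf4 (M + N) = 0" for N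
  proof -
    obtain p where p: "quad8 p = 0" "wt p = 1" "nalt p = N" using ex_nalt by blast
    then have "wt p \<noteq> 0" by simp
    then obtain z where z: "z \<in> switched X" "pol8 p z = 0" using switched_blocking [OF X card p(1)] by blast
    then have "z \<in> S" using \<open>wt p \<noteq> 0\<close> unfolding S_def wt_def by blast
    moreover have "pf4 (nalt z + N) = 0"
      using pf4_nalt [of z p] S [OF \<open>z \<in> S\<close>] p z by (simp add: pol8_commute)
    ultimately show ?thesis by blast
  qed
  moreover have "pf4 (M + N) \<noteq> 0" if "M \<in> nalt ` S" "N \<in> nalt ` S" "M \<noteq> N" for M N
  proof -
    from that obtain z z' where z: "z \<in> S" "z' \<in> S" "M = nalt z" "N = nalt z'" "z \<noteq> z'" by blast
    then have "pol8 z z' \<noteq> 0" using ne by blast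
    then show ?thesis using pf4_nalt [of z z'] S z by simp
  qed
  ultimately show ?thesis unfolding maximal_alt_spread_def by (intro exI [of _ "nalt ` S"] conjI ballI allI impI)
qed

section \<open>Configurations realizing the two sizes\<close>

lemma card_switched_conic:
  assumes "finite T" "T \<noteq> {}"
  shows "int (card (switched ((\<lambda>t. (t, t)) ` T))) = spread_size CARD('a) (card T)"
proof -
  have "card ((\<lambda>t. (t, t)) ` T) = card T" by (rule card_image) (auto simp: inj_on_def)
  then show ?thesis
    using card_Union_conic_hyp [OF assms] by (simp add: card_switched spread_size_def algebra_simps)
qed

lemma card_switched4:
  assumes "card T = 3" and "\<And>t. t \<in> T \<Longrightarrow> opposite (t, t) y" and "fst y \<noteq> snd y"
  shows "int (card (switched (insert y ((\<lambda>t. (t, t)) ` T)))) = spread_size CARD('a) 4 - 1"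
proof -
  have "finite T" by (rule card_ge_0_finite) (simp add: assms)
  moreover have "card ((\<lambda>t. (t, t)) ` T) = card T" by (rule card_image) (auto simp: inj_on_def)
  moreover have "y \<notin> (\<lambda>t. (t, t)) ` T" using assms(3) by auto
  ultimately have "card (insert y ((\<lambda>t. (t, t)) ` T)) = 4" using assms(1) by simp
  moreover have "(4::nat) choose 2 = 6" by (simp add: choose_two)
  ultimately show ?thesis
    using card_Union_hyp4 [OF assms] by (simp add: card_switched spread_size_def algebra_simps)
qed

lemma ex_maximal_alt_spread_conic:
  assumes "1 \<le> s" "3 * s + 1 < CARD('a)"
  shows "\<exists>Z. int (card Z) + 1 = spread_size CARD('a) s \<and> maximal_alt_spread (Z :: 'a alt4 set)"
proof -
  \<comment> \<open>In characteristic 2 only \<open>t = 1\<close> violates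
    \<open>t * t \<noteq> 1\<close>.\<close>
  have "s \<le> card (UNIV - {1::'a})" using assms by (simp add: card_Diff_singleton)
  then obtain T where T: "T \<subseteq> UNIV - {1::'a}" "card T = s" by (meson obtain_subset_with_card_n)
  then have "finite T" "T \<noteq> {}" using assms by auto
  let ?X = "(\<lambda>t. (t, t)) ` T"
  have "config ?X" using T \<open>T \<noteq> {}\<close> by (auto simp: config_def opposite_def sq_eq_1_iff)
  moreover have "card ?X = s" using T by (subst card_image) (auto simp: inj_on_def)
  ultimately show ?thesis
    using ex_maximal_alt_spread [of ?X] card_switched_conic [of T] assms T \<open>finite T\<close> \<open>T \<noteq> {}\<close> by simp
qed

lemma ex_maximal_alt_spread4:
  assumes "16 \<le> CARD('a)"
  shows "\<exists>Z. int (card Z) + 1 = spread_size CARD('a) 4 - 1 \<and> maximal_alt_spread (Z :: 'a alt4 set)"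
proof -
  have ex: "\<exists>x::'a. x \<notin> A" if "card A < 16" for A
  proof -
    have "A \<noteq> UNIV" using that assms by auto
    then show ?thesis by blast
  qed
  obtain a :: 'a where a: "a \<noteq> 0" "a \<noteq> 1" using ex [of "{0, 1}"] by auto
  have "card {0, 1, a, a + 1} \<le> 4" by (simp add: card_insert_if)
  then obtain b :: 'a where b: "b \<noteq> 0" "b \<noteq> 1" "b \<noteq> a" "b \<noteq> a + 1"
    using ex [of "{0, 1, a, a + 1}"] by auto
  have a1: "a + 1 \<noteq> 0" "a + 1 \<noteq> 1" "a + 1 \<noteq> a" "(1::'a) \<noteq> a + 1"
    using a by (auto simp: add_eq_0_char2)
  \<comment> \<open>As \<open>b \<noteq> 1\<close>, the point \<open>(1, b)\<close> is off the
    conic. It is opposite to the three conic points because neither 1 nor \<open>b\<close> is in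
    \<open>?T\<close>.\<close>
  let ?T = "{0, a, a + 1}" and ?y = "(1, b)"
  let ?X = "insert ?y ((\<lambda>t. (t, t)) ` ?T)"
  have op: "opposite (t, t) ?y" "opposite ?y (t, t)" if "t \<in> ?T" for t
    using that a b a1 by (auto simp: opposite_def)
  have T: "card ?T = 3" using a a1 by (auto simp: card_insert_if)
  have X: "config ?X"
    using op a a1 b by (auto simp: config_def sq_eq_1_iff opposite_def)
  moreover have "card ?X = 4" using a a1 b by (simp add: card_insert_if)
  \<comment> \<open>Four points require \<open>3 * 4 + 1 < q\<close>, which holds from 16
    on.\<close>
  ultimately have "\<exists>Z. int (card Z) + 1 = int (card (switched ?X)) \<and> maximal_alt_spread (Z :: 'a alt4 set)"
    using assms by (intro ex_maximal_alt_spread) simp_all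
  moreover have "int (card (switched ?X)) = spread_size CARD('a) 4 - 1"
    using T op(1) b by (intro card_switched4) auto
  ultimately show ?thesis by simp
qed

end

section \<open>From matrices to partial spreads\<close>

context cubic
begin

text \<open>The image of \<open>dual4 K\<close> lies in the kernel of \<open>K\<close>. The vector
  \<open>app4 (dual4 K) d\<close> is orthogonal to \<open>d\<close> because \<open>dual4 K\<close>
  is alternating; if it vanishes, the whole image is orthogonal to \<open>d\<close> by
  symmetry.\<close>

lemma ex_kernel_orthogonal:
  assumes "pf4 K = 0"
  shows "\<exists>v. v \<noteq> 0 \<and> app4 K v = 0 \<and> dot4 d v = (0 :: 'a)"
proof (cases "K = 0")
  case True
  then have K: "app4 K v = 0" for v by (cases v) (simp add: zero_prod_def)
  obtain d1 d2 d3 d4 where d: "d = (d1, d2, d3, d4)" by (cases d)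
  show ?thesis
  proof (cases "d1 = 0 \<and> d2 = 0")
    case True
    then show ?thesis by (intro exI [of _ "(1, 0, 0, 0)"]) (simp add: K, simp add: d zero_prod_def)
  next
    case False
    then show ?thesis
      by (intro exI [of _ "(d2, d1, 0, 0)"]) (simp add: K, auto simp: d zero_prod_def mult.commute)
  qed
next
  case False
  have ker: "app4 K (app4 (dual4 K) x) = 0" for x
    using assms app4_dual4 [of K x] by (cases x) (simp add: zero_prod_def)
  show ?thesis
  proof (cases "app4 (dual4 K) d = 0")
    case True
    obtain x where "app4 (dual4 K) x \<noteq> 0"
    proof (rule ccontr)
      assume "\<not> thesis"
      then have "app4 (dual4 K) x = 0" for x using that by blast
      from this [of "(1, 0, 0, 0)"] this [of "(0, 1, 0, 0)"] this [of "(0, 0, 1, 0)"]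
      show False using False by (cases K) (simp add: zero_prod_def)
    qed
    moreover have "dot4 d (app4 (dual4 K) x) = 0"
      using True dot4_app4_commute [of d "dual4 K" x] by (cases x) (simp add: zero_prod_def)
    ultimately show ?thesis using ker by blast
  next
    case False
    then show ?thesis using ker dot4_app4 by blast
  qed
qed

end

locale hyperbolic_space = cubic \<beta> + vector_space scale
  for \<beta> :: "'a::{field,finite}" and scale :: "'a \<Rightarrow> 'v::ab_group_add \<Rightarrow> 'v" +
  fixes Q :: "'v \<Rightarrow> 'a" and comb :: "'a vec4 \<Rightarrow> 'a vec4 \<Rightarrow> 'v"
  assumes comb_add: "comb v w + comb v' w' = comb (v + v') (w + w')"
    and comb_scale: "scale k (comb v w) = comb (smul4 k v) (smul4 k w)"
    and comb_bij: "bij (\<lambda>(v, w). comb v w)"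
    and Q_comb: "Q (comb v w) = dot4 v w"

context vector_space
begin

section \<open>Dimension by counting vectors\<close>

lemma card_span_independent:
  assumes "finite (UNIV :: 'a set)" "finite B" "independent B"
  shows "finite (span B) \<and> card (span B) = CARD('a) ^ card B"
  using assms(2,3)
proof (induction B rule: finite_induct)
  case (insert b B)
  have B: "independent B" "b \<notin> span B"
    using insert.prems insert.hyps by (auto simp: independent_insert)
  let ?f = "\<lambda>(k, x). scale k b + x"
  have "span (insert b B) = ?f ` (UNIV \<times> span B)"
  proof (intro equalityI subsetI)
    fix x assume "x \<in> span (insert b B)"
    then obtain k where "x - scale k b \<in> span B" by (auto simp: span_insert)
    then have "?f (k, x - scale k b) \<in> ?f ` (UNIV \<times> span B)" by (intro imageI) simp
    then show "x \<in> ?f ` (UNIV \<times> span B)" by simp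
  next
    fix x assume "x \<in> ?f ` (UNIV \<times> span B)"
    then obtain k y where "x = scale k b + y" "y \<in> span B" by auto
    then have "x - scale k b \<in> span B" by simp
    then show "x \<in> span (insert b B)" by (auto simp: span_insert)
  qed
  moreover have "inj_on ?f (UNIV \<times> span B)"
  proof (rule inj_onI, clarify)
    fix k x k' x'
    assume x: "x \<in> span B" "x' \<in> span B" and eq: "scale k b + x = scale k' b + x'"
    have "scale (k - k') b = x' - x" using eq by (simp add: scale_left_diff_distrib algebra_simps)
    then have *: "scale (k - k') b \<in> span B" using x by (simp add: span_diff)
    have "k = k'"
    proof (rule ccontr)
      assume "k \<noteq> k'"
      then have "b = scale (1 / (k - k')) (scale (k - k') b)" by simp
      then show False using span_scale [OF *] B(2) by metis
    qed
    then show "k = k' \<and> x = x'" using eq by simp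
  qed
  ultimately show ?case
    using insert.IH [OF B(1)] insert.hyps assms(1)
    by (simp add: card_image card_cartesian_product)
qed simp

text \<open>An infinite basis would have \<open>card\<close> equal to 0, so nonzero dimension forces
  a finite basis.\<close>

lemma card_subspace:
  assumes "finite (UNIV :: 'a set)" "subspace X" "finite X \<or> dim X \<noteq> 0"
  shows "finite X \<and> card X = CARD('a) ^ dim X"
proof -
  obtain B where B: "B \<subseteq> X" "independent B" "X \<subseteq> span B" "card B = dim X"
    using basis_exists by blast
  have "finite B" using assms(3) B by (metis card.infinite finite_subset)
  moreover have "span B = X" using B assms(2) span_minimal by blast
  ultimately show ?thesis using card_span_independent [OF assms(1) _ B(2)] B(4) by simp
qed

end

lemma card_field_gt_1: "CARD('a::{field,finite}) > 1"
  using card_mono [of UNIV "{0 :: 'a, 1}"] by simp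

context hyperbolic_space
begin

section \<open>Graphs of matrices as totally singular 4-spaces\<close>

lemma comb_eq_iff: "comb v w = comb v' w' \<longleftrightarrow> v = v' \<and> w = w'"
  using bij_is_inj [OF comb_bij] by (auto dest: injD [where x = "(v, w)" and y = "(v', w')"])

lemma ex_comb: "\<exists>v w. x = comb v w"
  using bij_is_surj [OF comb_bij] by (metis (no_types, lifting) surjD case_prod_beta)

lemma comb_0: "comb 0 0 = 0"
proof -
  have "comb 0 0 + comb 0 0 = comb 0 0" by (simp add: comb_add)
  then show ?thesis by simp
qed

lemma comb_eq_0_iff: "comb v w = 0 \<longleftrightarrow> v = 0 \<and> w = 0"
  using comb_eq_iff [of v w 0 0] by (simp add: comb_0)

lemma finite_vectors: "finite (S :: 'v set)"
proof -
  have "finite (range (\<lambda>(v, w). comb v w))" by (rule finite_imageI) simp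
  then have "finite (UNIV :: 'v set)" using bij_is_surj [OF comb_bij] by simp
  then show ?thesis by (rule rev_finite_subset) simp
qed

lemma dot4_add: "dot4 (v + v') w = dot4 v w + dot4 v' w" "dot4 w (v + v') = dot4 w v + dot4 w v'"
  for v v' w :: "'a vec4"
  by (cases v; cases v'; cases w; simp add: poly2)+

lemma polar_comb: "polar Q (comb v w) (comb v' w') = dot4 v w' + dot4 v' w"
  by (simp add: polar_def comb_add Q_comb dot4_add minus_char2 poly2)

definition graph :: "'a alt4 \<Rightarrow> 'v set" where
  "graph M = range (\<lambda>v. comb v (app4 M v))"

definition vertical :: "'v set" where
  "vertical = range (comb 0)"

lemma smul4_0 [simp]: "smul4 k 0 = (0 :: 'a vec4)"
  by (simp add: zero_prod_def)

lemma app4_0 [simp]: "app4 M 0 = (0 :: 'a vec4)"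
  by (cases M) (simp add: zero_prod_def)

lemma subspace_graph: "subspace (graph M)"
proof (rule subspaceI)
  show "0 \<in> graph M"
    unfolding graph_def by (rule range_eqI [of _ _ 0]) (simp add: comb_0)
next
  fix x y assume "x \<in> graph M" "y \<in> graph M"
  then obtain v w where "x = comb v (app4 M v)" "y = comb w (app4 M w)" unfolding graph_def by blast
  then have "x + y = comb (v + w) (app4 M (v + w))" by (simp only: comb_add app4_vec_add)
  then show "x + y \<in> graph M" unfolding graph_def by (rule range_eqI)
next
  fix k x assume "x \<in> graph M"
  then obtain v where "x = comb v (app4 M v)" unfolding graph_def by blast
  then have "scale k x = comb (smul4 k v) (app4 M (smul4 k v))" by (simp only: comb_scale app4_smul4)
  then show "scale k x \<in> graph M" unfolding graph_def by (rule range_eqI)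
qed

lemma subspace_vertical: "subspace vertical"
proof (rule subspaceI)
  show "0 \<in> vertical"
    unfolding vertical_def by (rule range_eqI [of _ _ 0]) (simp add: comb_0)
next
  fix x y assume "x \<in> vertical" "y \<in> vertical"
  then obtain v w where "x = comb 0 v" "y = comb 0 w" unfolding vertical_def by blast
  then have "x + y = comb 0 (v + w)" by (simp add: comb_add)
  then show "x + y \<in> vertical" unfolding vertical_def by (rule range_eqI)
next
  fix k x assume "x \<in> vertical"
  then obtain v where "x = comb 0 v" unfolding vertical_def by blast
  then have "scale k x = comb 0 (smul4 k v)" by (simp add: comb_scale)
  then show "scale k x \<in> vertical" unfolding vertical_def by (rule range_eqI)
qed

lemma card_graph: "card (graph M) = CARD('a) ^ 4" "card vertical = CARD('a) ^ 4"
proof -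
  have "inj (\<lambda>v. comb v (app4 M v))" "inj (comb 0)" by (auto simp: inj_def comb_eq_iff)
  then show "card (graph M) = CARD('a) ^ 4" "card vertical = CARD('a) ^ 4"
    unfolding graph_def vertical_def by (simp_all add: card_image power4_eq_xxxx mult.assoc)
qed

lemma dim_4_iff:
  assumes "subspace X" shows "dim X = 4 \<longleftrightarrow> card X = CARD('a) ^ 4"
  using card_subspace [OF finite assms] finite_vectors power_inject_exp [OF card_field_gt_1] by metis

lemma graph_Int_graph:
  assumes "pf4 (M + N) \<noteq> 0" shows "graph M \<inter> graph N = {0}"
proof (intro equalityI subsetI)
  fix x assume "x \<in> graph M \<inter> graph N"
  then obtain v where v: "x = comb v (app4 M v)" "app4 M v = app4 N v"
    by (auto simp: graph_def comb_eq_iff)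
  then have "app4 (M + N) v = 0" by (simp add: app4_add vec4_add_self)
  then have "v = 0" using assms app4_eq_0 by blast
  then show "x \<in> {0}" using v by (simp add: comb_0)
qed (use subspace_graph subspace_0 in auto)

lemma graph_Int_vertical: "graph M \<inter> vertical = {0}"
proof (intro equalityI subsetI)
  fix x assume "x \<in> graph M \<inter> vertical"
  then show "x \<in> {0}" by (auto simp: graph_def vertical_def comb_eq_iff comb_0)
qed (use subspace_graph subspace_vertical subspace_0 in auto)

lemma totally_singular_graph: "totally_singular Q (graph M)" "totally_singular Q vertical"
proof -
  have "dot4 0 w = (0 :: 'a)" for w by (cases w) (simp add: zero_prod_def)
  then show "totally_singular Q (graph M)" "totally_singular Q vertical"
    by (auto simp: totally_singular_def graph_def vertical_def Q_comb dot4_app4)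
qed

lemma totally_singular_imp_isotropic:
  assumes "subspace U" "totally_singular Q U" shows "totally_isotropic (polar Q) U"
  using assms by (simp add: totally_singular_def totally_isotropic_def polar_def subspace_add)

text \<open>A symmetric matrix is the sum of an alternating one and of \<open>d d\<^sup>T\<close>, where the squares of the
  entries of \<open>d\<close> are its diagonal.\<close>

lemma isotropic_complement:
  assumes W: "subspace W" "dim W = 4" "totally_isotropic (polar Q) W" "W \<inter> vertical = {0}"
  shows "\<exists>N d. \<forall>v. comb v (app4 N v + smul4 (dot4 d v) d) \<in> W"
proof -
  \<comment> \<open>As \<open>W\<close> meets \<open>vertical\<close> trivially, the projection to
    the first coordinate is injective on \<open>W\<close>, and onto by counting: \<open>W\<close> is
    a graph.\<close>
  let ?p = "\<lambda>x. fst (inv (\<lambda>(v, w). comb v w) x)"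
  have p: "?p (comb v w) = v" for v w
    using inv_f_f [OF bij_is_inj [OF comb_bij], of "(v, w)"] by simp
  have "inj_on ?p W"
  proof (rule inj_onI)
    fix x y assume xy: "x \<in> W" "y \<in> W" "?p x = ?p y"
    obtain v w where x: "x = comb v w" using ex_comb by blast
    obtain v' w' where y: "y = comb v' w'" using ex_comb by blast
    have "v = v'" using xy by (simp add: x y p)
    then have "x + y = comb 0 (w + w')" by (simp add: x y comb_add vec4_add_self)
    moreover have "x + y \<in> W" using xy(1,2) by (rule subspace_add [OF W(1)])
    ultimately have "x + y \<in> W \<inter> vertical" unfolding vertical_def by blast
    then have "comb 0 (w + w') = 0" using W(4) \<open>x + y = comb 0 (w + w')\<close> by auto
    then have "w + w' = 0" by (simp add: comb_eq_0_iff)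
    then have "w = w'" by (metis vec4_add_self add_right_cancel)
    then show "x = y" using \<open>v = v'\<close> x y by simp
  qed
  then have "card (?p ` W) = CARD('a) ^ 4"
    using dim_4_iff [OF W(1)] W(2) by (simp add: card_image)
  then have "?p ` W = UNIV"
    by (intro card_seteq) (auto simp: power4_eq_xxxx mult.assoc)
  have ex: "\<exists>w. comb v w \<in> W" for v
  proof -
    have "v \<in> ?p ` W" using \<open>?p ` W = UNIV\<close> by simp
    then obtain x where "x \<in> W" "v = ?p x" by blast
    then show ?thesis using ex_comb [of x] p by metis
  qed
  obtain a b c d where 1: "comb (1, 0, 0, 0) (a, b, c, d) \<in> W" using ex by (metis prod.exhaust)
  obtain b' e f g where 2: "comb (0, 1, 0, 0) (b', e, f, g) \<in> W" using ex by (metis prod.exhaust)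
  obtain c' f' h i where 3: "comb (0, 0, 1, 0) (c', f', h, i) \<in> W" using ex by (metis prod.exhaust)
  obtain d' g' i' j where 4: "comb (0, 0, 0, 1) (d', g', i', j) \<in> W" using ex by (metis prod.exhaust)
  have iso: "dot4 v w' + dot4 v' w = 0" if "comb v w \<in> W" "comb v' w' \<in> W" for v w v' w'
    using that W(3) by (auto simp: totally_isotropic_def polar_comb [symmetric])
  have sym: "b' = b" "c' = c" "d' = d" "f' = f" "g' = g" "i' = i"
    using iso [OF 1 2] iso [OF 1 3] iso [OF 1 4] iso [OF 2 3] iso [OF 2 4] iso [OF 3 4]
    by (simp_all add: add_eq_0_char2)
  obtain d1 where a: "a = d1 * d1" using sq_surj [of a] by metis
  obtain d2 where e: "e = d2 * d2" using sq_surj [of e] by metis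
  obtain d3 where h: "h = d3 * d3" using sq_surj [of h] by metis
  obtain d4 where j: "j = d4 * d4" using sq_surj [of j] by metis
  \<comment> \<open>Adding \<open>d d^T\<close> clears the diagonal of the symmetric matrix of the
    graph and leaves the alternating \<open>N\<close>.\<close>
  define N where "N = (b + d1 * d2, c + d1 * d3, d + d1 * d4, f + d2 * d3, g + d2 * d4, i + d3 * d4)"
  let ?d = "(d1, d2, d3, d4)"
  have "comb v (app4 N v + smul4 (dot4 ?d v) ?d) \<in> W" for v
  proof -
    obtain v1 v2 v3 v4 where v: "v = (v1, v2, v3, v4)" by (cases v)
    have "scale v1 (comb (1, 0, 0, 0) (a, b, c, d)) + scale v2 (comb (0, 1, 0, 0) (b', e, f, g))
      + scale v3 (comb (0, 0, 1, 0) (c', f', h, i)) + scale v4 (comb (0, 0, 0, 1) (d', g', i', j)) \<in> W"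
      by (intro subspace_add [OF W(1)] subspace_scale [OF W(1)] 1 2 3 4)
    also have "scale v1 (comb (1, 0, 0, 0) (a, b, c, d)) + scale v2 (comb (0, 1, 0, 0) (b', e, f, g))
      + scale v3 (comb (0, 0, 1, 0) (c', f', h, i)) + scale v4 (comb (0, 0, 0, 1) (d', g', i', j))
      = comb v (app4 N v + smul4 (dot4 ?d v) ?d)"
      by (simp add: comb_scale comb_add sym v N_def a e h j comb_eq_iff poly2)
    finally show ?thesis .
  qed
  then show ?thesis by blast
qed

text \<open>A further totally isotropic member would be the graph of some \<open>N + d d^T\<close>.
  Some \<open>M\<close> in \<open>Z\<close> has \<open>pf4 (M + N) = 0\<close>, and the two graphs
  agree on a kernel vector orthogonal to \<open>d\<close>. This settles both kinds of maximality,
  since orthogonal partial spreads are symplectic.\<close>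

lemma maximal_spread_of_alt_spread:
  assumes Z: "maximal_alt_spread (Z :: 'a alt4 set)"
  shows "\<exists>S. card S = card Z + 1 \<and> maximal_orthogonal_partial_spread scale Q S \<and>
    maximal_symplectic_partial_spread scale (polar Q) S"
proof -
  define S where "S = insert vertical (graph ` Z)"
  have pf: "pf4 (M + N) \<noteq> 0" if "M \<in> Z" "N \<in> Z" "M \<noteq> N" for M N
    using that Z unfolding maximal_alt_spread_def by blast
  have ne: "graph M \<noteq> {0}" "vertical \<noteq> {0}" for M
    using card_graph card_field_gt_1 [where 'a = 'a] by (metis card_1_singleton_iff One_nat_def nat_neq_iff one_less_power zero_less_numeral)+
  have "inj_on graph Z"
    using pf graph_Int_graph ne by (metis inf.idem inj_onI)
  moreover have "vertical \<notin> graph ` Z" using graph_Int_vertical ne by (metis imageE inf.idem)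
  ultimately have card: "card S = card Z + 1"
    by (simp add: S_def card_image)
  have S_cases: "U = vertical \<or> (\<exists>M\<in>Z. U = graph M)" if "U \<in> S" for U
    using that unfolding S_def by blast
  have mem: "subspace U \<and> dim U = 4 \<and> totally_singular Q U" if "U \<in> S" for U
    using S_cases [OF that]
  proof
    assume "U = vertical"
    then show ?thesis by (simp add: subspace_vertical totally_singular_graph card_graph dim_4_iff)
  next
    assume "\<exists>M\<in>Z. U = graph M"
    then obtain M where "U = graph M" by blast
    then show ?thesis by (simp add: subspace_graph totally_singular_graph card_graph dim_4_iff)
  qed
  have dis: "U \<inter> W = {0}" if "U \<in> S" "W \<in> S" "U \<noteq> W" for U W
  proof -
    consider "U = vertical" "W = vertical" | M where "U = vertical" "W = graph M" | M where "U = graph M" "W = vertical"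
      | M N where "M \<in> Z" "N \<in> Z" "U = graph M" "W = graph N"
      using S_cases [OF \<open>U \<in> S\<close>] S_cases [OF \<open>W \<in> S\<close>] by metis
    then show ?thesis
    proof cases
      case 1
      then show ?thesis using that by simp
    next
      case 2
      then show ?thesis using graph_Int_vertical by (simp add: inf_commute)
    next
      case 3
      then show ?thesis using graph_Int_vertical by simp
    next
      case 4
      then show ?thesis using that(3) pf graph_Int_graph by metis
    qed
  qed
  have no: False
    if T: "symplectic_partial_spread scale (polar Q) T" "S \<subset> T" for T
  proof -
    obtain W where W: "W \<in> T" "W \<notin> S" using T by blast
    have Wd: "subspace W" "dim W = 4" "totally_isotropic (polar Q) W"
      using T W unfolding symplectic_partial_spread_def by blast+
    have WU: "W \<inter> U = {0}" if "U \<in> S" for U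
    proof -
      have "U \<in> T" "W \<noteq> U" using T(2) W that by auto
      then show ?thesis using T(1) W(1) by (simp add: symplectic_partial_spread_def)
    qed
    have "vertical \<in> S" by (simp add: S_def)
    then have "\<exists>N d. \<forall>v. comb v (app4 N v + smul4 (dot4 d v) d) \<in> W"
      by (intro isotropic_complement Wd WU)
    then obtain N d where N: "\<forall>v. comb v (app4 N v + smul4 (dot4 d v) d) \<in> W" by (elim exE)
    obtain M where M: "M \<in> Z" "pf4 (M + N) = 0" using Z unfolding maximal_alt_spread_def by blast
    obtain v where v: "v \<noteq> 0" "app4 (M + N) v = 0" "dot4 d v = 0"
      using ex_kernel_orthogonal M(2) by blast
    have "app4 M v = app4 N v"
      using v(2) by (metis app4_add vec4_add_self add_right_cancel)
    moreover have "smul4 0 d = 0" by (cases d) (simp add: zero_prod_def)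
    ultimately have "comb v (app4 M v) \<in> W" using N [rule_format, of v] v(3) by simp
    moreover have "comb v (app4 M v) \<in> graph M" by (simp add: graph_def)
    ultimately have "comb v (app4 M v) = 0" using WU [of "graph M"] M(1) by (auto simp: S_def)
    then show False using v(1) by (simp add: comb_eq_0_iff)
  qed
  have iso: "symplectic_partial_spread scale (polar Q) T" if "orthogonal_partial_spread scale Q T" for T
    using that totally_singular_imp_isotropic
    unfolding orthogonal_partial_spread_def symplectic_partial_spread_def by blast
  have "orthogonal_partial_spread scale Q S"
    unfolding orthogonal_partial_spread_def using mem dis by blast
  then have "maximal_orthogonal_partial_spread scale Q S"
    "maximal_symplectic_partial_spread scale (polar Q) S"
    unfolding maximal_orthogonal_partial_spread_def maximal_symplectic_partial_spread_def
    using no iso by blast+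
  then show ?thesis using card by blast
qed

end

section \<open>Hyperbolic bases\<close>

locale quadratic_space = vector_space scale
  for scale :: "'a::field \<Rightarrow> 'v::ab_group_add \<Rightarrow> 'v" +
  fixes Q :: "'v \<Rightarrow> 'a"
  assumes quadratic: "quadratic_form scale Q"
begin

abbreviation B :: "'v \<Rightarrow> 'v \<Rightarrow> 'a" where "B \<equiv> polar Q"

lemma B_linear: "B (x + y) z = B x z + B y z" "B (scale k x) z = k * B x z"
  "B z (x + y) = B z x + B z y" "B z (scale k x) = k * B z x"
proof -
  have 1: "module_hom scale (*) (B z)" "module_hom scale (*) (\<lambda>x. B x z)" for z
    using quadratic unfolding quadratic_form_def module_hom_iff_linear by auto
  show "B (x + y) z = B x z + B y z" "B (scale k x) z = k * B x z"
    "B z (x + y) = B z x + B z y" "B z (scale k x) = k * B z x"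
    using module_hom.add [OF 1(1)] module_hom.scale [OF 1(1)] module_hom.add [OF 1(2)] module_hom.scale [OF 1(2)]
    by auto
qed

lemma B_0: "B 0 z = 0" "B z 0 = 0"
  using B_linear(2) [of 0 0 z] B_linear(4) [of z 0 0] by simp_all

lemma B_sum: "B (sum f A) z = (\<Sum>a\<in>A. B (f a) z)"
  by (induction A rule: infinite_finite_induct) (simp_all add: B_0 B_linear)

lemma B_commute: "B x y = B y x"
  by (simp add: polar_def add.commute)

lemma Q_add: "Q (x + y) = Q x + Q y + B x y"
  by (simp add: polar_def)

lemma Q_scale: "Q (scale k x) = k\<^sup>2 * Q x"
  using quadratic by (simp add: quadratic_form_def)

text \<open>Induction on \<open>E\<close>, passing from \<open>K\<close> to the kernel of
  \<open>B e\<close> in \<open>K\<close>. A vector of \<open>K\<close> outside of this kernel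
  determines the coefficient of \<open>B e\<close>.\<close>

lemma functional_in_span:
  assumes "finite E" "subspace K"
    and "\<And>x. x \<in> K \<Longrightarrow> (\<forall>e\<in>E. B e x = 0) \<Longrightarrow> B u x = 0"
  shows "\<exists>c. \<forall>x\<in>K. B u x = (\<Sum>e\<in>E. c e * B e x)"
  using assms
proof (induction E arbitrary: K rule: finite_induct)
  case (insert e E)
  have K': "subspace {x \<in> K. B e x = 0}"
    using insert.prems(1) by (auto simp: subspace_def B_0 B_linear)
  have "\<exists>c. \<forall>x\<in>{x \<in> K. B e x = 0}. B u x = (\<Sum>e\<in>E. c e * B e x)"
    using insert.prems(2) by (intro insert.IH [OF K']) auto
  then obtain c where c: "\<And>x. x \<in> K \<Longrightarrow> B e x = 0 \<Longrightarrow> B u x = (\<Sum>e\<in>E. c e * B e x)" by blast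
  show ?case
  proof (cases "\<exists>y\<in>K. B e y \<noteq> 0")
    case False
    then have "B u x = (\<Sum>e'\<in>insert e E. c e' * B e' x)" if "x \<in> K" for x
      using that c insert.hyps by simp
    then show ?thesis by blast
  next
    case True
    then obtain y where y: "y \<in> K" "B e y \<noteq> 0" by blast
    define d where "d = (B u y - (\<Sum>e\<in>E. c e * B e y)) / B e y"
    have "B u x = (\<Sum>e'\<in>insert e E. (if e' = e then d else c e') * B e' x)" if "x \<in> K" for x
    proof -
      define k where "k = - (B e x / B e y)"
      have "x + scale k y \<in> K"
        using that y insert.prems(1) by (intro subspace_add subspace_scale)
      moreover have "B e (x + scale k y) = 0"
        using y by (simp only: B_linear) (simp add: k_def)
      ultimately have "B u x + k * B u y = (\<Sum>e\<in>E. c e * (B e x + k * B e y))"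
        using c [of "x + scale k y"] by (simp add: B_linear)
      also have "\<dots> = (\<Sum>e\<in>E. c e * B e x) + k * (\<Sum>e\<in>E. c e * B e y)"
        by (simp add: algebra_simps sum.distrib sum_distrib_left)
      finally have "B u x = (\<Sum>e\<in>E. c e * B e x) + d * B e x"
        using y by (simp add: d_def k_def field_simps)
      moreover have "(\<Sum>e'\<in>E. (if e' = e then d else c e') * B e' x) = (\<Sum>e'\<in>E. c e' * B e' x)"
        using insert.hyps by (intro sum.cong) auto
      ultimately show ?thesis using insert.hyps by simp
    qed
    then show ?thesis by (intro exI [of _ "\<lambda>e'. if e' = e then d else c e'"] ballI)
  qed
qed auto

text \<open>Otherwise \<open>B e\<close> is a combination of the other functionals, and
  \<open>e\<close> minus the same combination of vectors is singular and in the radical. So it is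
  zero, against independence.\<close>

lemma ex_dual_vector:
  assumes nondeg: "nondegenerate_quadratic_form Q"
    and E: "finite E" "independent E" "totally_singular Q (span E)" and e: "e \<in> E"
  shows "\<exists>x. B e x = 1 \<and> (\<forall>e'\<in>E - {e}. B e' x = 0)"
proof (rule ccontr)
  assume no: "\<not> ?thesis"
  have "B e x = 0" if "\<forall>e'\<in>E - {e}. B e' x = 0" for x
  proof (rule ccontr)
    assume "B e x \<noteq> 0"
    then have "B e (scale (1 / B e x) x) = 1 \<and> (\<forall>e'\<in>E - {e}. B e' (scale (1 / B e x) x) = 0)"
      using that by (simp add: B_linear)
    then show False using no by blast
  qed
  then have "\<exists>c. \<forall>x\<in>UNIV. B e x = (\<Sum>e'\<in>E - {e}. c e' * B e' x)"
    using E(1) by (intro functional_in_span) auto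
  then obtain c where c: "B e x = (\<Sum>e'\<in>E - {e}. c e' * B e' x)" for x by blast
  define u where "u = (\<Sum>e'\<in>E - {e}. scale (c e') e')"
  have u: "u \<in> span (E - {e})" unfolding u_def by (intro span_sum span_scale span_base)
  have "e + scale (-1) u \<in> span E"
    using u e span_mono [of "E - {e}" E] by (intro span_add span_scale) (auto intro: span_base)
  then have "Q (e + scale (-1) u) = 0" using E(3) by (simp add: totally_singular_def)
  moreover have "B (e + scale (-1) u) x = 0" for x
    by (simp only: B_linear c [of x]) (simp add: u_def B_sum B_linear)
  ultimately have "e + scale (-1) u = 0" using nondeg unfolding nondegenerate_quadratic_form_def by blast
  then have "e = u" by simp
  then show False using u E(2) e by (auto simp: dependent_def)
qed

end

fun lincomb4 :: "('a \<Rightarrow> 'v \<Rightarrow> 'v) \<Rightarrow> 'v vec4 \<Rightarrow> 'a vec4 \<Rightarrow> 'v::ab_group_add" where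
  "lincomb4 scale (e1, e2, e3, e4) (v1, v2, v3, v4) =
    scale v1 e1 + scale v2 e2 + scale v3 e3 + scale v4 e4"

context cubic
begin

lemma O8_plus_hyperbolic:
  assumes O8: "O8_plus_space scale Q"
  shows "\<exists>comb. hyperbolic_space \<beta> scale Q (comb :: 'a vec4 \<Rightarrow> 'a vec4 \<Rightarrow> 'v::ab_group_add)"
proof -
  interpret vector_space scale using O8 by (simp add: O8_plus_space_def)
  interpret quadratic_space scale Q
    using O8 by unfold_locales (simp add: O8_plus_space_def)
  have nondeg: "nondegenerate_quadratic_form Q" and dim8: "dim UNIV = 8"
    using O8 by (simp_all add: O8_plus_space_def)
  obtain U where U: "subspace U" "dim U = 4" "totally_singular Q U"
    using O8 by (auto simp: O8_plus_space_def)
  obtain E where E: "E \<subseteq> U" "independent E" "U \<subseteq> span E" "card E = 4"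
    using basis_exists [of U] U(2) by auto
  then have span: "span E = U" using U(1) span_minimal by blast
  have finE: "finite E" using E(4) by (simp add: card_ge_0_finite)
  obtain e1 e2 e3 e4 where E4: "E = {e1, e2, e3, e4}" "distinct [e1, e2, e3, e4]"
  proof -
    obtain xs where xs: "set xs = E" "distinct xs" using finite_distinct_list [OF finE] by blast
    have "length xs = Suc (Suc (Suc (Suc 0)))" using E(4) distinct_card [OF xs(2)] unfolding xs(1) by simp
    then obtain a b c d where "xs = [a, b, c, d]" unfolding length_Suc_conv by auto
    then have "E = {a, b, c, d}" "distinct [a, b, c, d]" using xs by simp_all
    then show ?thesis by (rule that)
  qed
  have dual: "\<exists>x. B e x = 1 \<and> (\<forall>e'\<in>E - {e}. B e' x = 0)" if "e \<in> E" for e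
    using ex_dual_vector [OF nondeg finE E(2) _ that] U(3) span by simp
  obtain g1 where g1: "B e1 g1 = 1" "B e2 g1 = 0" "B e3 g1 = 0" "B e4 g1 = 0"
    using dual [of e1] E4 by auto
  obtain g2 where g2: "B e1 g2 = 0" "B e2 g2 = 1" "B e3 g2 = 0" "B e4 g2 = 0"
    using dual [of e2] E4 by auto
  obtain g3 where g3: "B e1 g3 = 0" "B e2 g3 = 0" "B e3 g3 = 1" "B e4 g3 = 0"
    using dual [of e3] E4 by auto
  obtain g4 where g4: "B e1 g4 = 0" "B e2 g4 = 0" "B e3 g4 = 0" "B e4 g4 = 1"
    using dual [of e4] E4 by auto
  have Ue: "Q e = 0" if "e \<in> E" for e using that E(1) U(3) by (auto simp: totally_singular_def)
  have Be: "B e e' = 0" if "e \<in> E" "e' \<in> E" for e e'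
  proof -
    have "e \<in> U" "e' \<in> U" using that E(1) by auto
    then have "Q e = 0" "Q e' = 0" "Q (e + e') = 0"
      using U(3) subspace_add [OF U(1)] by (simp_all add: totally_singular_def)
    then show ?thesis by (simp add: polar_def)
  qed
  have Qe: "Q e1 = 0" "Q e2 = 0" "Q e3 = 0" "Q e4 = 0" using Ue E4 by auto
  have Bee: "B e1 e1 = 0" "B e1 e2 = 0" "B e1 e3 = 0" "B e1 e4 = 0"
    "B e2 e1 = 0" "B e2 e2 = 0" "B e2 e3 = 0" "B e2 e4 = 0"
    "B e3 e1 = 0" "B e3 e2 = 0" "B e3 e3 = 0" "B e3 e4 = 0"
    "B e4 e1 = 0" "B e4 e2 = 0" "B e4 e3 = 0" "B e4 e4 = 0"
    using Be E4 by auto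
  note eg = g1 g2 g3 g4
  have ge: "B g1 e1 = 1" "B g1 e2 = 0" "B g1 e3 = 0" "B g1 e4 = 0"
    "B g2 e1 = 0" "B g2 e2 = 1" "B g2 e3 = 0" "B g2 e4 = 0"
    "B g3 e1 = 0" "B g3 e2 = 0" "B g3 e3 = 1" "B g3 e4 = 0"
    "B g4 e1 = 0" "B g4 e2 = 0" "B g4 e3 = 0" "B g4 e4 = 1"
    using eg by (simp_all add: B_commute [of g1] B_commute [of g2] B_commute [of g3] B_commute [of g4])
  \<comment> \<open>In characteristic 2 the term in the matching \<open>e\<close> cancels the value
    of \<open>Q\<close>, and the terms in the earlier ones cancel the pairings with the earlier
    \<open>f\<close>. Pairings with the \<open>e\<close> do not change.\<close>
  define f1 where "f1 = g1 + scale (Q g1) e1"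
  define f2 where "f2 = g2 + scale (Q g2) e2 + scale (B g1 g2) e1"
  define f3 where "f3 = g3 + scale (Q g3) e3 + scale (B g1 g3) e1 + scale (B g2 g3) e2"
  define f4 where "f4 = g4 + scale (Q g4) e4 + scale (B g1 g4) e1 + scale (B g2 g4) e2 + scale (B g3 g4) e3"
  note f_def = f1_def f2_def f3_def f4_def
  note tab = eg ge Bee Qe B_linear
  have ef: "B e1 f1 = 1" "B e1 f2 = 0" "B e1 f3 = 0" "B e1 f4 = 0"
    "B e2 f1 = 0" "B e2 f2 = 1" "B e2 f3 = 0" "B e2 f4 = 0"
    "B e3 f1 = 0" "B e3 f2 = 0" "B e3 f3 = 1" "B e3 f4 = 0"
    "B e4 f1 = 0" "B e4 f2 = 0" "B e4 f3 = 0" "B e4 f4 = 1"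
    by (simp_all add: f_def tab)
  have ff: "B f1 f2 = 0" "B f1 f3 = 0" "B f1 f4 = 0" "B f2 f3 = 0" "B f2 f4 = 0" "B f3 f4 = 0"
    by (simp_all add: f_def tab)
  have Qf: "Q f1 = 0" "Q f2 = 0" "Q f3 = 0" "Q f4 = 0"
    by (simp_all add: f_def tab Q_add Q_scale)
  have Bff: "B x x = 0" for x
  proof -
    have "x + x = scale (1 + 1) x" by (simp only: scale_left_distrib scale_one)
    then have "x + x = 0" by (simp only: char2 scale_zero_left)
    moreover have "Q 0 = 0" using Q_scale [of 0 0] by simp
    ultimately show ?thesis by (simp add: polar_def minus_char2)
  qed
  define comb where "comb v w = lincomb4 scale (e1, e2, e3, e4) v + lincomb4 scale (f1, f2, f3, f4) w" for v w
  have fe: "B f1 e1 = 1" "B f1 e2 = 0" "B f1 e3 = 0" "B f1 e4 = 0"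
    "B f2 e1 = 0" "B f2 e2 = 1" "B f2 e3 = 0" "B f2 e4 = 0"
    "B f3 e1 = 0" "B f3 e2 = 0" "B f3 e3 = 1" "B f3 e4 = 0"
    "B f4 e1 = 0" "B f4 e2 = 0" "B f4 e3 = 0" "B f4 e4 = 1"
    using ef by (simp_all add: B_commute [of f1] B_commute [of f2] B_commute [of f3] B_commute [of f4])
  have ff': "B f2 f1 = 0" "B f3 f1 = 0" "B f4 f1 = 0" "B f3 f2 = 0" "B f4 f2 = 0" "B f4 f3 = 0"
    using ff by (simp_all add: B_commute)
  note tab' = ef fe ff ff' Bff Qf Bee Qe B_linear
  \<comment> \<open>Pairing with the \<open>e\<close> recovers \<open>w\<close>, pairing with the
    \<open>f\<close> recovers \<open>v\<close>.\<close>
  have coord: "comb v w = comb v' w' \<Longrightarrow> v = v' \<and> w = w'" for v w v' w'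
  proof -
    have 1: "w = (B e1 (comb v w), B e2 (comb v w), B e3 (comb v w), B e4 (comb v w))" for v w
      by (cases v; cases w) (simp add: comb_def tab')
    have 2: "v = (B f1 (comb v w), B f2 (comb v w), B f3 (comb v w), B f4 (comb v w))" for v w
      by (cases v; cases w) (simp add: comb_def tab')
    show "comb v w = comb v' w' \<Longrightarrow> v = v' \<and> w = w'" by (metis 1 2)
  qed
  have inj: "inj (\<lambda>(v, w). comb v w)"
    by (rule injI) (use coord in \<open>auto split: prod.splits\<close>)
  have UNIV: "finite (UNIV :: 'v set)" "card (UNIV :: 'v set) = CARD('a) ^ 8"
    using card_subspace [of UNIV] dim8 by (simp_all add: subspace_UNIV)
  have "card (range (\<lambda>(v, w). comb v w)) = CARD('a) ^ 8"
    using card_image [OF inj] by (simp add: card_cartesian_product numeral_eq_Suc mult.assoc)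
  then have surj: "range (\<lambda>(v, w). comb v w) = UNIV"
    using UNIV by (intro card_seteq) auto
  have "hyperbolic_space \<beta> scale Q comb"
  proof
    show "comb v w + comb v' w' = comb (v + v') (w + w')" for v w v' w'
      by (cases v; cases w; cases v'; cases w') (simp add: comb_def scale_left_distrib algebra_simps)
    show "scale k (comb v w) = comb (smul4 k v) (smul4 k w)" for k v w
      by (cases v; cases w) (simp add: comb_def scale_right_distrib)
    show "bij (\<lambda>(v, w). comb v w)" using inj surj by (simp add: bij_def)
    show "Q (comb v w) = dot4 v w" for v w
      by (cases v; cases w) (simp add: comb_def Q_add Q_scale tab')
  qed
  then show ?thesis by blast
qed

end

section \<open>Characteristic 2 and the choice of \<beta>\<close>

lemma even_card_imp_char2:
  assumes "even CARD('a::{field,finite})"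
  shows "(1 :: 'a) + 1 = 0"
proof (rule ccontr)
  assume two: "(1 :: 'a) + 1 \<noteq> 0"
  have ne: "- x \<noteq> x" if "x \<noteq> 0" for x :: 'a
  proof
    assume "- x = x"
    then have "x * (1 + 1) = 0" by (metis add.right_inverse distrib_left mult_1_right)
    then show False using that two by simp
  qed
  \<comment> \<open>The nonzero elements would fall into pairs \<open>{x, - x}\<close>, making the
    order of the field odd.\<close>
  let ?P = "(\<lambda>x. {x, - x}) ` (UNIV - {0 :: 'a})"
  have "card (\<Union>?P) = (\<Sum>A\<in>?P. card A)"
    by (rule card_Union_disjoint) (auto simp: pairwise_def disjnt_def)
  also have "\<dots> = (\<Sum>A\<in>?P. 2)"
  proof (rule sum.cong)
    fix A assume "A \<in> ?P"
    then obtain x where "A = {x, - x}" "x \<noteq> 0" by blast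
    then show "card A = 2" using ne [of x, symmetric] by simp
  qed simp
  finally have "even (card (\<Union>?P))" by simp
  moreover have "\<Union>?P = UNIV - {0 :: 'a}" by auto
  ultimately have "even (CARD('a) - 1)" by (simp add: card_Diff_singleton)
  moreover have "CARD('a) \<noteq> 0" by simp
  ultimately show False using assms by presburger
qed

text \<open>The map \<open>y^3 + y\<close> takes the same value at 0 and 1, so on a finite field it
  is not onto; a missed value gives \<beta>.\<close>

lemma ex_cubic_without_root:
  assumes "(1 :: 'a::{field,finite}) + 1 = 0"
  shows "\<exists>\<beta> :: 'a. cubic \<beta>"
proof -
  let ?f = "\<lambda>y :: 'a. y * y * y + y"
  have 01: "?f 0 = ?f 1" using assms by simp
  have "\<not> inj ?f"
  proof
    assume "inj ?f"
    from injD [OF this 01] show False by simp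
  qed
  then have "\<not> surj ?f" using finite_UNIV_surj_inj [of ?f] by auto
  then obtain b where b: "\<And>y. b \<noteq> ?f y" unfolding surj_def by blast
  have "?f y + - b \<noteq> 0" for y
    using b [of y] eq_neg_iff_add_eq_0 [of "?f y" "- b"] by simp
  then have "cubic (- b)" using assms by unfold_locales auto
  then show ?thesis ..
qed

theorem theorem7p3:
  fixes scale :: "'a::{field,finite} \<Rightarrow> 'v::ab_group_add \<Rightarrow> 'v"
    and Q :: "'v \<Rightarrow> 'a"
    and q :: nat
  assumes "CARD('a) = q" and "even q" and "q > 2"
    and "O8_plus_space scale Q"
  shows "(\<forall>s::nat. 1 \<le> s \<and> real s \<le> real q / 5 \<longrightarrow>
            (\<exists>S. int (card S) = spread_size q s \<and>
                 maximal_orthogonal_partial_spread scale Q S \<and>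
                 maximal_symplectic_partial_spread scale (polar Q) S)) \<and>
         (q \<ge> 16 \<longrightarrow>
            (\<exists>S. int (card S) = spread_size q 4 - 1 \<and>
                 maximal_orthogonal_partial_spread scale Q S \<and>
                 maximal_symplectic_partial_spread scale (polar Q) S))"
proof -
  have "(1 :: 'a) + 1 = 0" using assms(1,2) by (intro even_card_imp_char2) simp
  then obtain \<beta> :: 'a where "cubic \<beta>" using ex_cubic_without_root by blast
  then interpret cubic \<beta> .
  obtain comb where "hyperbolic_space \<beta> scale Q comb" using O8_plus_hyperbolic [OF assms(4)] by blast
  then interpret hyperbolic_space \<beta> scale Q comb .
  have ex: "\<exists>S. int (card S) = n \<and> maximal_orthogonal_partial_spread scale Q S \<and>
      maximal_symplectic_partial_spread scale (polar Q) S"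
    if ex: "\<exists>Z. int (card Z) + 1 = n \<and> maximal_alt_spread (Z :: 'a alt4 set)" for n
  proof -
    obtain Z :: "'a alt4 set" where Z: "int (card Z) + 1 = n" "maximal_alt_spread Z" using ex by blast
    then obtain S where "card S = card Z + 1" "maximal_orthogonal_partial_spread scale Q S"
      "maximal_symplectic_partial_spread scale (polar Q) S"
      using maximal_spread_of_alt_spread by blast
    then show ?thesis using Z(1) by (intro exI [of _ S]) simp
  qed
  show ?thesis
  proof (intro conjI allI impI; (elim conjE)?)
    fix s :: nat assume s: "1 \<le> s" "real s \<le> real q / 5"
    then have "5 * s \<le> q" by linarith
    \<comment> \<open>For \<open>s \<ge> 1\<close> one has \<open>3 * s + 1 < 5 * s\<close>.\<close>
    then have "3 * s + 1 < CARD('a)" using s assms(1) by linarith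
    then show "\<exists>S. int (card S) = spread_size q s \<and> maximal_orthogonal_partial_spread scale Q S \<and>
        maximal_symplectic_partial_spread scale (polar Q) S"
      using ex ex_maximal_alt_spread_conic [OF s(1)] assms(1) by simp
  next
    assume "q \<ge> 16"
    then show "\<exists>S. int (card S) = spread_size q 4 - 1 \<and> maximal_orthogonal_partial_spread scale Q S \<and>
        maximal_symplectic_partial_spread scale (polar Q) S"
      using ex ex_maximal_alt_spread4 assms(1) by simp
  qed
qed

end
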